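(* Let $G$ be a topological group. The Roelcke compactification $b_rG$ is the maximal (i.e. greatest) element of $\mathbb{G}^{\leftrightarrow}(G)$ and of $\mathbb{G}^*(G)$.
   Context: All spaces are Tychonoff. A compactification of $G$ is a pair $(bG,b)$ with $bG$ compact (Hausdorff) and $b:G\to bG$ a topological embedding with dense image; $G$ is identified with $b(G)$. Write $b'G\geq bG$ if there is a continuous $f:b'G\to bG$ with $b=f\circ b'$; compactifications are identified when each is $\geq$ the other. Let $\alpha(g,h)=gh$ and $\alpha^*(g,h)=hg^{-1}$ (two left actions of $G$ on itself), and $*(g)=g^{-1}$. A $G$-compactification of $G$ is a compactification to which $\alpha$ extends as a continuous action $G\times bG\to bG$. A $G^{\leftrightarrow}$-compactification is one to which both $\alpha$ and $\alpha^*$ extend as continuous actions. A $G^*$-compactification is a $G$-compactification $bG$ with a continuous map $s:bG\to bG$, $s\circ s=\mathrm{id}$, such that $s|_G=*$. $\mathbb{G}^{\leftrightarrow}(G)$ and $\mathbb{G}^*(G)$ are the posets of $G^{\leftrightarrow}$- and $G^*$-compactifications of $G$, ordered by $\leq$. The Roelcke uniformity $L\wedge R$ on $G$ has as a base the uniform covers $\{OgO: g\in G\}$, $O$ an open neighborhood of the unit. $b_rG$ is the Samuel compactification of $(G,L\wedge R)$, i.e. the completion of $G$ with respect to the finest totally bounded uniformity contained in $L\wedge R$. *)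

theory Defs
  imports "HOL-Analysis.Analysis"
begin

text \<open>
  The group G is a type of class \<open>topological_group_add\<close>. This class is the library's
  notion of a topological group. It is not assumed commutative; the group
  operation is written additively, so gh reads \<open>g + h\<close>, \<open>h g\<^sup>-\<^sup>1\<close> reads \<open>h - g\<close> and the unit is
  \<open>0\<close>. The standing assumption that spaces are Tychonoff becomes \<open>t2_space\<close>, as a Hausdorff
  topological group is Tychonoff.
\<close>

section \<open>Compactifications\<close>

definition is_compactification :: "'b topology \<Rightarrow> ('a::topological_space \<Rightarrow> 'b) \<Rightarrow> bool" where
  "is_compactification Y b \<longleftrightarrow>
     compact_space Y \<and> Hausdorff_space Y \<and>
     embedding_map euclidean Y b \<and> Y closure_of (range b) = topspace Y"

text \<open>
  \<open>compactification_le Y b Y' b'\<close> says that (Y', b') is \<open>\<ge>\<close> (Y, b). This is a preorder; the poset of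
  compactifications is its quotient by mutual comparability.
\<close>

definition compactification_le ::
    "'b topology \<Rightarrow> ('a \<Rightarrow> 'b) \<Rightarrow> 'c topology \<Rightarrow> ('a \<Rightarrow> 'c) \<Rightarrow> bool" where
  "compactification_le Y b Y' b' \<longleftrightarrow> (\<exists>f. continuous_map Y' Y f \<and> b = f \<circ> b')"

definition left_translation :: "'a::group_add \<Rightarrow> 'a \<Rightarrow> 'a" where
  "left_translation g h = g + h"

definition right_translation :: "'a::group_add \<Rightarrow> 'a \<Rightarrow> 'a" where
  "right_translation g h = h - g"

definition continuous_action ::
    "'b topology \<Rightarrow> ('a::topological_group_add \<Rightarrow> 'b \<Rightarrow> 'b) \<Rightarrow> bool" where
  "continuous_action Y act \<longleftrightarrow>
     continuous_map (prod_topology euclidean Y) Y (\<lambda>(g, y). act g y) \<and>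
     (\<forall>y\<in>topspace Y. act 0 y = y) \<and>
     (\<forall>g h. \<forall>y\<in>topspace Y. act (g + h) y = act g (act h y))"

definition extends_to_continuous_action ::
    "('a::topological_group_add \<Rightarrow> 'a \<Rightarrow> 'a) \<Rightarrow> 'b topology \<Rightarrow> ('a \<Rightarrow> 'b) \<Rightarrow> bool" where
  "extends_to_continuous_action \<theta> Y b \<longleftrightarrow>
     (\<exists>act. continuous_action Y act \<and> (\<forall>g h. act g (b h) = b (\<theta> g h)))"

definition G_compactification ::
    "'b topology \<Rightarrow> ('a::topological_group_add \<Rightarrow> 'b) \<Rightarrow> bool" where
  "G_compactification Y b \<longleftrightarrow>
     is_compactification Y b \<and> extends_to_continuous_action left_translation Y b"

definition G_lr_compactification ::
    "'b topology \<Rightarrow> ('a::topological_group_add \<Rightarrow> 'b) \<Rightarrow> bool" where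
  "G_lr_compactification Y b \<longleftrightarrow>
     is_compactification Y b \<and> extends_to_continuous_action left_translation Y b \<and>
     extends_to_continuous_action right_translation Y b"

definition G_star_compactification ::
    "'b topology \<Rightarrow> ('a::topological_group_add \<Rightarrow> 'b) \<Rightarrow> bool" where
  "G_star_compactification Y b \<longleftrightarrow>
     G_compactification Y b \<and>
     (\<exists>s. continuous_map Y Y s \<and> (\<forall>y\<in>topspace Y. s (s y) = y) \<and> (\<forall>g. s (b g) = b (- g)))"

section \<open>Uniformities as filters of entourages\<close>

text \<open>
  The library's uniform spaces, with the uniformity as an argument rather than fixed by the type.
  The first argument of \<open>class.uniform_space\<close> is the family of open sets, which has to be
  the topology induced by U.
\<close>

definition is_uniformity :: "('a \<times> 'a) filter \<Rightarrow> bool" where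
  "is_uniformity U \<longleftrightarrow>
     class.uniform_space (\<lambda>S. \<forall>x\<in>S. eventually (\<lambda>(x', y). x' = x \<longrightarrow> y \<in> S) U) U"

text \<open>
  The entourage of a cover C is the union of \<open>A \<times> A\<close> over A in C.
\<close>

definition uniformity_of_covers :: "'a set set set \<Rightarrow> ('a \<times> 'a) filter" where
  "uniformity_of_covers \<C> = (INF C\<in>\<C>. principal (\<Union>A\<in>C. A \<times> A))"

definition roelcke_cover :: "'a::group_add set \<Rightarrow> 'a set set" where
  "roelcke_cover N = range (\<lambda>g. {u + g + v | u v. u \<in> N \<and> v \<in> N})"

definition roelcke_uniformity :: "('a::topological_group_add \<times> 'a) filter" where
  "roelcke_uniformity = uniformity_of_covers {roelcke_cover N | N. open N \<and> 0 \<in> N}"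

text \<open>
  Filters are ordered by reverse inclusion: \<open>U \<le> V\<close> means that the uniformity V is contained in U,
  so the finest uniformity with a property is the least filter.
\<close>

definition finest_totally_bounded :: "('a \<times> 'a) filter \<Rightarrow> ('a \<times> 'a) filter" where
  "finest_totally_bounded U =
     (LEAST V. is_uniformity V \<and> uniform_space.totally_bounded V UNIV \<and> U \<le> V)"

section \<open>Completion of a uniform space\<close>

text \<open>
  Bourbaki's Hausdorff completion: its points are the minimal Cauchy filters, two of them are close
  of order E if they have a common E-small member, and a point x is mapped to its neighbourhood
  filter.
\<close>

definition completion_points :: "('a \<times> 'a) filter \<Rightarrow> 'a filter set" where
  "completion_points U =
     {F. F \<noteq> bot \<and> uniform_space.cauchy_filter U F \<and>
         (\<forall>F'. F' \<noteq> bot \<and> uniform_space.cauchy_filter U F' \<and> F \<le> F' \<longrightarrow> F' = F)}"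

definition completion_entourage ::
    "('a \<times> 'a) filter \<Rightarrow> ('a \<times> 'a) set \<Rightarrow> ('a filter \<times> 'a filter) set" where
  "completion_entourage U E =
     {(F, F'). F \<in> completion_points U \<and> F' \<in> completion_points U \<and>
        (\<exists>A. eventually (\<lambda>x. x \<in> A) F \<and> eventually (\<lambda>x. x \<in> A) F' \<and> A \<times> A \<subseteq> E)}"

definition completion_topology :: "('a \<times> 'a) filter \<Rightarrow> 'a filter topology" where
  "completion_topology U =
     topology (\<lambda>W. W \<subseteq> completion_points U \<and>
       (\<forall>F\<in>W. \<exists>E. eventually (\<lambda>p. p \<in> E) U \<and> completion_entourage U E `` {F} \<subseteq> W))"

definition completion_map :: "('a \<times> 'a) filter \<Rightarrow> 'a \<Rightarrow> 'a filter" where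
  "completion_map U x = filtercomap (\<lambda>y. (x, y)) U"

lemma openin_completion_topology:
  "openin (completion_topology U) W \<longleftrightarrow> W \<subseteq> completion_points U \<and>
     (\<forall>F\<in>W. \<exists>E. eventually (\<lambda>p. p \<in> E) U \<and> completion_entourage U E `` {F} \<subseteq> W)"
proof -
  have mono: "completion_entourage U (E \<inter> E') `` {F} \<subseteq>
      completion_entourage U E `` {F} \<inter> completion_entourage U E' `` {F}" for E E' F
    unfolding completion_entourage_def by auto
  have "istopology (\<lambda>W. W \<subseteq> completion_points U \<and>
      (\<forall>F\<in>W. \<exists>E. eventually (\<lambda>p. p \<in> E) U \<and> completion_entourage U E `` {F} \<subseteq> W))"
    unfolding istopology_def
  proof (intro conjI allI impI; (elim conjE)?)
    fix S T
    assume S: "S \<subseteq> completion_points U"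
        "\<forall>F\<in>S. \<exists>E. eventually (\<lambda>p. p \<in> E) U \<and> completion_entourage U E `` {F} \<subseteq> S"
      and T: "\<forall>F\<in>T. \<exists>E. eventually (\<lambda>p. p \<in> E) U \<and> completion_entourage U E `` {F} \<subseteq> T"
    show "S \<inter> T \<subseteq> completion_points U" using S by blast
    show "\<forall>F\<in>S \<inter> T. \<exists>E. eventually (\<lambda>p. p \<in> E) U \<and> completion_entourage U E `` {F} \<subseteq> S \<inter> T"
    proof
      fix F assume "F \<in> S \<inter> T"
      then obtain E E' where E: "eventually (\<lambda>p. p \<in> E) U" "completion_entourage U E `` {F} \<subseteq> S"
        and E': "eventually (\<lambda>p. p \<in> E') U" "completion_entourage U E' `` {F} \<subseteq> T"
        using S T by blast
      have "eventually (\<lambda>p. p \<in> E \<inter> E') U" using E E' by (simp add: eventually_conj_iff)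
      moreover have "completion_entourage U (E \<inter> E') `` {F} \<subseteq> S \<inter> T"
        using mono[of E E' F] E E' by blast
      ultimately show "\<exists>E. eventually (\<lambda>p. p \<in> E) U \<and> completion_entourage U E `` {F} \<subseteq> S \<inter> T"
        by blast
    qed
  next
    fix \<K>
    assume K: "\<forall>K\<in>\<K>. K \<subseteq> completion_points U \<and>
      (\<forall>F\<in>K. \<exists>E. eventually (\<lambda>p. p \<in> E) U \<and> completion_entourage U E `` {F} \<subseteq> K)"
    show "\<Union>\<K> \<subseteq> completion_points U" using K by blast
    show "\<forall>F\<in>\<Union>\<K>. \<exists>E. eventually (\<lambda>p. p \<in> E) U \<and> completion_entourage U E `` {F} \<subseteq> \<Union>\<K>"
      using K by (meson Union_iff Union_upper subset_trans)
  qed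
  then show ?thesis
    unfolding completion_topology_def by (simp add: topology_inverse')
qed

section \<open>The Samuel and Roelcke compactifications\<close>

definition samuel_space :: "('a \<times> 'a) filter \<Rightarrow> 'a filter topology" where
  "samuel_space U = completion_topology (finest_totally_bounded U)"

definition samuel_map :: "('a \<times> 'a) filter \<Rightarrow> 'a \<Rightarrow> 'a filter" where
  "samuel_map U = completion_map (finest_totally_bounded U)"

definition roelcke_space :: "'a::topological_group_add filter topology" where
  "roelcke_space = samuel_space roelcke_uniformity"

definition roelcke_map :: "'a::topological_group_add \<Rightarrow> 'a filter" where
  "roelcke_map = samuel_map roelcke_uniformity"

end

theory Submission
  imports Defs
begin

text \<open>
  Call A well inside B if B contains the image of A under some entourage of the uniformity U. This
  proximity determines the totally bounded reflection of U, which is generated by the sets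
  \<open>B \<times> B \<union> (- A) \<times> (- A)\<close>, and the points, the topology and the universal property of its
  completion can all be expressed through it. For the Roelcke uniformity, A is well inside B iff
  \<open>N + A + N \<subseteq> B\<close> for a neighbourhood N of 0. Left translations and inversion preserve this
  relation, so they act on the completion by direct images of filters, and the neighbourhood N
  makes the action jointly continuous. Conversely, if both actions extend to a compactification Y,
  then for \<open>C \<subseteq> W\<close> with C closed and W open in Y the tube lemma gives an N whose two-sided action
  carries C into W. So the traces of C and W on the group are in this relation, which is what the
  extension of the embedding to the Roelcke compactification requires.
\<close>

section \<open>Proximity of a uniformity\<close>

text \<open>\<open>class.uniform_space\<close> also ties the open sets to the entourages; for the
  induced family of open sets that clause is a tautology, so only the three entourage axioms
  remain.\<close>

lemma is_uniformity_iff: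
  "is_uniformity U \<longleftrightarrow>
     (\<forall>E. eventually E U \<longrightarrow> (\<forall>x. E (x, x))) \<and>
     (\<forall>E. eventually E U \<longrightarrow> eventually (\<lambda>(x, y). E (y, x)) U) \<and>
     (\<forall>E. eventually E U \<longrightarrow>
        (\<exists>D. eventually D U \<and> (\<forall>x y z. D (x, y) \<longrightarrow> D (y, z) \<longrightarrow> E (x, z))))"
  unfolding is_uniformity_def class.uniform_space_def class.open_uniformity_def
    class.uniform_space_axioms_def by auto

definition well_inside :: "('a \<times> 'a) filter \<Rightarrow> 'a set \<Rightarrow> 'a set \<Rightarrow> bool" where
  "well_inside U A B \<longleftrightarrow> eventually (\<lambda>(x, y). x \<in> A \<longrightarrow> y \<in> B) U"

text \<open>When A is contained in B, the sets B and - A cover the type, and this is the entourage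
  of that two-element cover.\<close>

definition dichotomy_entourage :: "'a set \<Rightarrow> 'a set \<Rightarrow> ('a \<times> 'a) set" where
  "dichotomy_entourage A B = B \<times> B \<union> (- A) \<times> (- A)"

definition totally_bounded_reflection :: "('a \<times> 'a) filter \<Rightarrow> ('a \<times> 'a) filter" where
  "totally_bounded_reflection U =
     (INF (A, B)\<in>{(A, B). well_inside U A B}. principal (dichotomy_entourage A B))"

lemma well_inside_mono:
  "well_inside U A B \<Longrightarrow> A' \<subseteq> A \<Longrightarrow> B \<subseteq> B' \<Longrightarrow> well_inside U A' B'"
  unfolding well_inside_def by (erule eventually_mono) auto

lemma well_inside_Int:
  "well_inside U A B \<Longrightarrow> well_inside U A' B' \<Longrightarrow> well_inside U (A \<inter> A') (B \<inter> B')"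
  unfolding well_inside_def by (erule (1) eventually_elim2) auto

lemma well_inside_UNIV [simp]: "well_inside U A UNIV"
  by (simp add: well_inside_def case_prod_unfold)

lemma square_subset_dichotomy_entourage:
  "C \<times> C \<subseteq> dichotomy_entourage A B \<longleftrightarrow> C \<subseteq> B \<or> C \<subseteq> - A"
  unfolding dichotomy_entourage_def by blast

text \<open>Finite intersections of the generating entourages form a base. The finite set
  \<open>X\<close> is what later makes total boundedness a counting argument.\<close>

lemma eventually_totally_bounded_reflection:
  "eventually P (totally_bounded_reflection U) \<longleftrightarrow>
     (\<exists>X. finite X \<and> (\<forall>(A, B)\<in>X. well_inside U A B) \<and>
        (\<forall>p. (\<forall>(A, B)\<in>X. p \<in> dichotomy_entourage A B) \<longrightarrow> P p))"
proof -
  have *: "eventually P (INF (A, B)\<in>X. principal (dichotomy_entourage A B)) \<longleftrightarrow>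
      (\<forall>p. (\<forall>(A, B)\<in>X. p \<in> dichotomy_entourage A B) \<longrightarrow> P p)"
    if "finite X" for X :: "('a set \<times> 'a set) set"
  proof -
    have "(INF (A, B)\<in>X. principal (dichotomy_entourage A B)) =
        principal (\<Inter>(A, B)\<in>X. dichotomy_entourage A B)"
      using INF_principal_finite[OF that, of "\<lambda>(A, B). dichotomy_entourage A B"]
      by (simp only: case_prod_unfold)
    then show ?thesis
      by (simp only: eventually_principal Ball_def INT_iff) blast
  qed
  have "eventually P (totally_bounded_reflection U) \<longleftrightarrow>
      (\<exists>X. finite X \<and> X \<subseteq> {(A, B). well_inside U A B} \<and>
        eventually P (INF (A, B)\<in>X. principal (dichotomy_entourage A B)))"
    unfolding totally_bounded_reflection_def by (subst eventually_INF) blast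
  also have "\<dots> \<longleftrightarrow> (\<exists>X. finite X \<and> X \<subseteq> {(A, B). well_inside U A B} \<and>
        (\<forall>p. (\<forall>(A, B)\<in>X. p \<in> dichotomy_entourage A B) \<longrightarrow> P p))"
    by (intro ex_cong1 conj_cong refl *)
  also have "\<dots> \<longleftrightarrow> (\<exists>X. finite X \<and> (\<forall>(A, B)\<in>X. well_inside U A B) \<and>
        (\<forall>p. (\<forall>(A, B)\<in>X. p \<in> dichotomy_entourage A B) \<longrightarrow> P p))"
    by (intro ex_cong1 conj_cong refl) auto
  finally show ?thesis .
qed

lemma eventually_totally_bounded_reflectionI:
  "well_inside U A B \<Longrightarrow>
     eventually (\<lambda>p. p \<in> dichotomy_entourage A B) (totally_bounded_reflection U)"
  unfolding eventually_totally_bounded_reflection by (rule exI[of _ "{(A, B)}"]) auto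

text \<open>Zorn's lemma gives a minimal proper filter below \<open>F\<close>, because the infimum
  of a nonempty chain of proper filters is proper. Minimality makes it decide every A: its
  restriction to A is either trivial or the whole filter.\<close>

lemma ultrafilter_below:
  fixes F :: "'a filter"
  assumes "F \<noteq> bot"
  obtains G where "G \<le> F" "G \<noteq> bot" "\<And>A. (\<forall>\<^sub>F x in G. x \<in> A) \<or> (\<forall>\<^sub>F x in G. x \<in> - A)"
proof -
  let ?S = "{G. G \<le> F \<and> G \<noteq> bot}"
  have "\<exists>m\<in>?S. \<forall>a\<in>?S. a \<le> m \<longrightarrow> a = m"
  proof (rule predicate_Zorn)
    show "partial_order_on ?S (relation_of (\<lambda>a b. b \<le> a) ?S)"
      by (rule partial_order_on_relation_ofI) auto
    fix C assume "C \<in> Chains (relation_of (\<lambda>a b. b \<le> a) ?S)"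
    then have C: "\<And>a. a \<in> C \<Longrightarrow> a \<in> ?S" "\<And>a b. a \<in> C \<Longrightarrow> b \<in> C \<Longrightarrow> a \<le> b \<or> b \<le> a"
      unfolding Chains_def relation_of_def by blast+
    show "\<exists>u\<in>?S. \<forall>a\<in>C. u \<le> a"
    proof (cases "C = {}")
      case True
      then show ?thesis using assms by auto
    next
      case False
      have base: "\<exists>x\<in>C. x \<le> inf a b" if "a \<in> C" "b \<in> C" for a b
        using C(2)[OF that] that by (metis inf.absorb1 inf.absorb2 order_refl)
      have "Inf C \<noteq> bot"
      proof
        assume "Inf C = bot"
        then have "eventually (\<lambda>_. False) (Inf C)" by simp
        then obtain a where "a \<in> C" "eventually (\<lambda>_. False) a"
          using eventually_Inf_base[OF False base] by blast
        then show False using C(1)[of a] by simp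
      qed
      moreover have "Inf C \<le> F"
        using False C(1) by (metis (mono_tags, lifting) Inf_lower2 equals0I mem_Collect_eq)
      ultimately show ?thesis by (intro bexI[of _ "Inf C"]) (auto intro: Inf_lower)
    qed
  qed
  then obtain G where G: "G \<le> F" "G \<noteq> bot"
    and least: "\<And>H. H \<le> G \<Longrightarrow> H \<noteq> bot \<Longrightarrow> H = G"
    by (metis (mono_tags, lifting) mem_Collect_eq order_trans)
  have "(\<forall>\<^sub>F x in G. x \<in> A) \<or> (\<forall>\<^sub>F x in G. x \<in> - A)" for A
  proof (cases "inf G (principal A) = bot")
    case True
    then have "eventually (\<lambda>_. False) (inf G (principal A))" by simp
    then show ?thesis unfolding eventually_inf_principal by simp
  next
    case False
    then have "inf G (principal A) = G" by (intro least) auto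
    then have "G \<le> principal A" by (metis inf.cobounded2)
    then show ?thesis by (simp add: le_principal)
  qed
  then show ?thesis using G that by blast
qed

section \<open>Uniform structures and their totally bounded reflection\<close>

locale uniform_structure =
  fixes U :: "('a \<times> 'a) filter"
  assumes is_uniformity: "is_uniformity U"
begin

lemma entourage_refl: "eventually E U \<Longrightarrow> E (x, x)"
  and entourage_sym: "eventually E U \<Longrightarrow> eventually (\<lambda>(x, y). E (y, x)) U"
  and entourage_trans: "eventually E U \<Longrightarrow>
        \<exists>D. eventually D U \<and> (\<forall>x y z. D (x, y) \<longrightarrow> D (y, z) \<longrightarrow> E (x, z))"
  using is_uniformity unfolding is_uniformity_iff by blast+

lemma entourage_sym_square:
  assumes "eventually E U"
  obtains D where "eventually D U" "\<And>x y. D (x, y) \<Longrightarrow> D (y, x)"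
    "\<And>x y z. D (x, y) \<Longrightarrow> D (y, z) \<Longrightarrow> E (x, z)"
proof -
  obtain D where D: "eventually D U" "\<And>x y z. D (x, y) \<Longrightarrow> D (y, z) \<Longrightarrow> E (x, z)"
    using entourage_trans[OF assms] by blast
  show ?thesis
  proof (rule that[of "\<lambda>p. D p \<and> D (snd p, fst p)"])
    show "eventually (\<lambda>p. D p \<and> D (snd p, fst p)) U"
      using D(1) entourage_sym[OF D(1)] by (simp add: eventually_conj_iff case_prod_unfold)
  qed (use D(2) in auto)
qed

lemma well_inside_subset: "well_inside U A B \<Longrightarrow> A \<subseteq> B"
  unfolding well_inside_def using entourage_refl by fastforce

lemma well_inside_Compl: "well_inside U A B \<Longrightarrow> well_inside U (- B) (- A)"
  unfolding well_inside_def by (drule entourage_sym) (erule eventually_mono, auto)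

text \<open>The interpolating set is the neighbourhood of A of order D, where D composed with itself
  lies in the given entourage. Below, this density property replaces direct work with composed
  entourages.\<close>

lemma well_inside_interpolate:
  assumes "well_inside U A B"
  obtains C where "well_inside U A C" "well_inside U C B"
proof -
  obtain D where D: "eventually D U" "\<And>x y z. D (x, y) \<Longrightarrow> D (y, z) \<Longrightarrow> x \<in> A \<Longrightarrow> z \<in> B"
    using entourage_trans[OF assms[unfolded well_inside_def]] by auto
  show ?thesis
  proof (rule that[of "{y. \<exists>x\<in>A. D (x, y)}"])
    show "well_inside U A {y. \<exists>x\<in>A. D (x, y)}"
      unfolding well_inside_def using D(1) by (rule eventually_mono) auto
    show "well_inside U {y. \<exists>x\<in>A. D (x, y)} B"
      unfolding well_inside_def using D(1) by (rule eventually_mono) (use D(2) in auto)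
  qed
qed

lemma is_uniformity_reflection: "is_uniformity (totally_bounded_reflection U)"
  unfolding is_uniformity_iff
proof (intro conjI allI impI)
  fix E :: "'a \<times> 'a \<Rightarrow> bool" assume "eventually E (totally_bounded_reflection U)"
  then obtain X where X: "finite X" "\<And>A B. (A, B) \<in> X \<Longrightarrow> well_inside U A B"
    and E: "\<And>p. (\<And>A B. (A, B) \<in> X \<Longrightarrow> p \<in> dichotomy_entourage A B) \<Longrightarrow> E p"
    unfolding eventually_totally_bounded_reflection by fast
  show "E (x, x)" for x
    by (rule E) (auto simp: dichotomy_entourage_def dest: X(2) well_inside_subset)
  show "eventually (\<lambda>(x, y). E (y, x)) (totally_bounded_reflection U)"
    unfolding eventually_totally_bounded_reflection
  proof (intro exI[of _ X] conjI allI impI)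
    fix p assume "\<forall>(A, B)\<in>X. p \<in> dichotomy_entourage A B"
    then show "case p of (x, y) \<Rightarrow> E (y, x)"
      unfolding dichotomy_entourage_def by (cases p) (auto intro!: E simp: dichotomy_entourage_def)
  qed (use X in auto)
  have "\<forall>p\<in>X. \<exists>C. well_inside U (fst p) C \<and> well_inside U C (snd p)"
    using X(2) well_inside_interpolate by (metis prod.collapse)
  then obtain C where C: "\<And>p. p \<in> X \<Longrightarrow> well_inside U (fst p) (C p)"
    "\<And>p. p \<in> X \<Longrightarrow> well_inside U (C p) (snd p)"
    by metis
  \<comment> \<open>Each pair (A, B) of \<open>X\<close> is split at its interpolant C. The middle
    point y decides: if y is in C, the dichotomy for (C, B) puts x and z in B; otherwise the one for
    (A, C) keeps both outside A.\<close>
  define D where "D q \<longleftrightarrow>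
    (\<forall>p\<in>X. q \<in> dichotomy_entourage (fst p) (C p) \<and> q \<in> dichotomy_entourage (C p) (snd p))" for q
  have "eventually D (totally_bounded_reflection U)"
    unfolding D_def using X(1)
    by (auto intro!: eventually_ball_finite eventually_conj eventually_totally_bounded_reflectionI C)
  moreover have "E (x, z)" if "D (x, y)" "D (y, z)" for x y z
  proof (rule E)
    fix A B assume "(A, B) \<in> X"
    then show "(x, z) \<in> dichotomy_entourage A B"
      using that unfolding D_def dichotomy_entourage_def by fastforce
  qed
  ultimately show "\<exists>D. eventually D (totally_bounded_reflection U) \<and>
      (\<forall>x y z. D (x, y) \<longrightarrow> D (y, z) \<longrightarrow> E (x, z))"
    by blast
qed

text \<open>As A is contained in B, each generator contains the intersection of the two entourages
  that witness A well inside B and, by symmetry, - B well inside - A.\<close>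

lemma le_reflection: "U \<le> totally_bounded_reflection U"
  unfolding totally_bounded_reflection_def
proof (rule INF_greatest, clarify)
  fix A B assume AB: "well_inside U A B"
  show "U \<le> principal (dichotomy_entourage A B)"
    using AB well_inside_Compl[OF AB] unfolding le_principal well_inside_def
    by eventually_elim (use well_inside_subset[OF AB] in \<open>auto simp: dichotomy_entourage_def\<close>)
qed

text \<open>This allows the completion of the reflection to be described in terms of
  \<open>U\<close> alone. A pair in the dichotomy entourage whose first coordinate is in A must have
  its second one in B.\<close>

lemma well_inside_reflection:
  "well_inside (totally_bounded_reflection U) A B \<longleftrightarrow> well_inside U A B"
proof
  assume "well_inside U A B"
  from eventually_totally_bounded_reflectionI[OF this]
  show "well_inside (totally_bounded_reflection U) A B"
    unfolding well_inside_def by (rule eventually_mono) (auto simp: dichotomy_entourage_def)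
next
  assume "well_inside (totally_bounded_reflection U) A B"
  then show "well_inside U A B"
    unfolding well_inside_def by (rule filter_leD[OF le_reflection])
qed

lemma totally_bounded_reflection:
  "uniform_space.totally_bounded (totally_bounded_reflection U) UNIV"
  unfolding uniform_space.totally_bounded_def[OF is_uniformity_reflection[unfolded is_uniformity_def]]
proof (intro allI impI)
  fix E assume "eventually E (totally_bounded_reflection U)"
  then obtain X where X: "finite X" "\<And>A B. (A, B) \<in> X \<Longrightarrow> well_inside U A B"
    and E: "\<And>p. (\<And>A B. (A, B) \<in> X \<Longrightarrow> p \<in> dichotomy_entourage A B) \<Longrightarrow> E p"
    unfolding eventually_totally_bounded_reflection by fast
  \<comment> \<open>The type of x: the pairs of \<open>X\<close> whose larger set contains x. There
    are finitely many types, and two points of equal type are close, since for each (A, B) both lie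
    in B or both lie outside B and hence outside A.\<close>
  define c where "c x = {p\<in>X. x \<in> snd p}" for x
  have "finite (range c)"
    by (rule finite_subset[of _ "Pow X"]) (use X(1) in \<open>auto simp: c_def\<close>)
  then obtain Y where Y: "finite Y" "range c = c ` Y"
    by (metis finite_subset_image order_refl)
  have "\<exists>x\<in>Y. E (x, s)" for s
  proof -
    obtain x where x: "x \<in> Y" "c x = c s"
      using Y(2) by (metis imageE rangeI)
    have "E (x, s)"
    proof (rule E)
      fix A B assume AB: "(A, B) \<in> X"
      then have "x \<in> B \<longleftrightarrow> s \<in> B"
        using x(2) unfolding c_def by (auto simp: set_eq_iff)
      moreover have "A \<subseteq> B"
        using X(2)[OF AB] by (rule well_inside_subset)
      ultimately show "(x, s) \<in> dichotomy_entourage A B"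
        by (auto simp: dichotomy_entourage_def)
    qed
    then show ?thesis using x by blast
  qed
  then show "\<exists>Y. finite Y \<and> (\<forall>s\<in>UNIV. \<exists>x\<in>Y. E (x, s))"
    using Y(1) by blast
qed

text \<open>A finite net for a refined entourage D' gives finitely many pairs of balls, that of
  order D' well inside that of order D around the same centre. Their dichotomies imply E: the first
  coordinate lies in some ball of order D', so both coordinates lie in the ball of order D with that
  centre.\<close>

lemma reflection_least:
  assumes V: "is_uniformity V" "uniform_space.totally_bounded V UNIV" and "U \<le> V"
  shows "totally_bounded_reflection U \<le> V"
proof (rule filter_leI)
  interpret V: uniform_structure V by standard fact
  fix E assume "eventually E V"
  then obtain D where D: "eventually D V" "\<And>x y. D (x, y) \<Longrightarrow> D (y, x)"
      "\<And>x y z. D (x, y) \<Longrightarrow> D (y, z) \<Longrightarrow> E (x, z)"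
    using V.entourage_sym_square by metis
  obtain D' where D': "eventually D' V" "\<And>x y z. D' (x, y) \<Longrightarrow> D' (y, z) \<Longrightarrow> D (x, z)"
    using V.entourage_trans[OF D(1)] by blast
  obtain Y where Y: "finite Y" "\<And>s. \<exists>x\<in>Y. D' (x, s)"
    using V(2) D'(1) uniform_space.totally_bounded_def[OF V(1)[unfolded is_uniformity_def]]
    by (metis UNIV_I)
  have wi: "well_inside U {y. D' (x, y)} {y. D (x, y)}" for x
  proof -
    have "well_inside V {y. D' (x, y)} {y. D (x, y)}"
      unfolding well_inside_def using D'(1) by (rule eventually_mono) (use D'(2) in auto)
    then show ?thesis
      using \<open>U \<le> V\<close> unfolding well_inside_def by (metis filter_leD)
  qed
  show "eventually E (totally_bounded_reflection U)"
    unfolding eventually_totally_bounded_reflection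
  proof (intro exI[of _ "(\<lambda>x. ({y. D' (x, y)}, {y. D (x, y)})) ` Y"] conjI allI impI)
    fix p assume "\<forall>(A, B)\<in>(\<lambda>x. ({y. D' (x, y)}, {y. D (x, y)})) ` Y. p \<in> dichotomy_entourage A B"
    then have p: "p \<in> dichotomy_entourage {y. D' (x, y)} {y. D (x, y)}" if "x \<in> Y" for x
      using that by blast
    obtain x where x: "x \<in> Y" "D' (x, fst p)"
      using Y(2) by blast
    have "D (x, fst p)" "D (x, snd p)"
      using p[OF x(1)] x(2) by (auto simp: dichotomy_entourage_def)
    then have "E (fst p, snd p)"
      using D by blast
    then show "E p" by simp
  qed (use Y wi in auto)
qed

lemma finest_totally_bounded_eq: "finest_totally_bounded U = totally_bounded_reflection U"
  unfolding finest_totally_bounded_def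
  by (rule Least_equality)
    (auto intro: is_uniformity_reflection totally_bounded_reflection le_reflection reflection_least)


section \<open>Points of the completion as round filters\<close>

text \<open>The members of the coarser filter are the sets that have a member of \<open>F\<close>
  well inside them. Interpolation makes it round, that is, each member has another member well
  inside it. This is how a filter that decides all dichotomies produces a point of the
  completion.\<close>

lemma round_filter_above:
  assumes "F \<noteq> bot"
    and cauchy: "\<And>A B. well_inside U A B \<Longrightarrow> (\<forall>\<^sub>F x in F. x \<in> B) \<or> (\<forall>\<^sub>F x in F. x \<in> - A)"
  obtains F' where "F \<le> F'" "F' \<noteq> bot"
    "\<And>A B. well_inside U A B \<Longrightarrow> (\<forall>\<^sub>F x in F'. x \<in> B) \<or> (\<forall>\<^sub>F x in F'. x \<in> - A)"
    "\<And>A. (\<forall>\<^sub>F x in F'. x \<in> A) \<Longrightarrow> \<exists>B. (\<forall>\<^sub>F x in F. x \<in> B) \<and> well_inside U B A"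
    "\<And>A. (\<forall>\<^sub>F x in F'. x \<in> A) \<Longrightarrow> \<exists>B. (\<forall>\<^sub>F x in F'. x \<in> B) \<and> well_inside U B A"
proof -
  define F' where "F' = Abs_filter (\<lambda>P. \<exists>B. (\<forall>\<^sub>F x in F. x \<in> B) \<and> well_inside U B (Collect P))"
  have ev: "eventually P F' \<longleftrightarrow> (\<exists>B. (\<forall>\<^sub>F x in F. x \<in> B) \<and> well_inside U B (Collect P))" for P
    unfolding F'_def
  proof (rule eventually_Abs_filter, rule is_filter.intro)
    show "\<exists>B. (\<forall>\<^sub>F x in F. x \<in> B) \<and> well_inside U B {x. True}"
      by (rule exI[of _ UNIV]) simp
  next
    fix P Q
    assume "\<exists>B. (\<forall>\<^sub>F x in F. x \<in> B) \<and> well_inside U B (Collect P)"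
      "\<exists>B. (\<forall>\<^sub>F x in F. x \<in> B) \<and> well_inside U B (Collect Q)"
    then obtain B C where "\<forall>\<^sub>F x in F. x \<in> B" "well_inside U B (Collect P)"
      "\<forall>\<^sub>F x in F. x \<in> C" "well_inside U C (Collect Q)" by blast
    then show "\<exists>B. (\<forall>\<^sub>F x in F. x \<in> B) \<and> well_inside U B {x. P x \<and> Q x}"
      using well_inside_Int[of U B "Collect P" C "Collect Q"]
      by (intro exI[of _ "B \<inter> C"]) (simp add: eventually_conj_iff Collect_conj_eq)
  next
    fix P Q :: "'a \<Rightarrow> bool"
    assume "\<forall>x. P x \<longrightarrow> Q x" "\<exists>B. (\<forall>\<^sub>F x in F. x \<in> B) \<and> well_inside U B (Collect P)"
    then show "\<exists>B. (\<forall>\<^sub>F x in F. x \<in> B) \<and> well_inside U B (Collect Q)"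
      by (meson Collect_mono order_refl well_inside_mono)
  qed
  show ?thesis
  proof
    show "F \<le> F'"
    proof (rule filter_leI)
      fix P assume "eventually P F'"
      then obtain B where "\<forall>\<^sub>F x in F. x \<in> B" "B \<subseteq> Collect P"
        unfolding ev using well_inside_subset by blast
      then show "eventually P F" by (auto elim: eventually_mono)
    qed
    show "F' \<noteq> bot"
    proof
      assume "F' = bot"
      then obtain B where "\<forall>\<^sub>F x in F. x \<in> B" "well_inside U B {x. False}"
        using ev[of "\<lambda>_. False"] by auto
      then show False
        using \<open>F \<noteq> bot\<close> well_inside_subset by fastforce
    qed
    show "\<exists>B. (\<forall>\<^sub>F x in F. x \<in> B) \<and> well_inside U B A" if "\<forall>\<^sub>F x in F'. x \<in> A" for A
      using that by (simp add: ev)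
    show "\<exists>B. (\<forall>\<^sub>F x in F'. x \<in> B) \<and> well_inside U B A" if "\<forall>\<^sub>F x in F'. x \<in> A" for A
    proof -
      obtain B where B: "\<forall>\<^sub>F x in F. x \<in> B" "well_inside U B A"
        using \<open>\<forall>\<^sub>F x in F'. x \<in> A\<close> unfolding ev Collect_mem_eq by blast
      obtain C where "well_inside U B C" "well_inside U C A"
        using B(2) by (rule well_inside_interpolate)
      then show ?thesis using B(1) unfolding ev Collect_mem_eq by blast
    qed
    fix A B assume "well_inside U A B"
    then obtain C where C: "well_inside U A C" "well_inside U C B"
      by (rule well_inside_interpolate)
    \<comment> \<open>With A, D, C, B each well inside the next, \<open>F\<close> decides the middle
      pair; the outer two pairs provide the room to pass from C to B or from - D to - A.\<close>
    obtain D where D: "well_inside U A D" "well_inside U D C"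
      using C(1) by (rule well_inside_interpolate)
    from cauchy[OF D(2)]
    show "(\<forall>\<^sub>F x in F'. x \<in> B) \<or> (\<forall>\<^sub>F x in F'. x \<in> - A)"
    proof
      assume "\<forall>\<^sub>F x in F. x \<in> C"
      then show ?thesis using C(2) unfolding ev Collect_mem_eq by blast
    next
      assume "\<forall>\<^sub>F x in F. x \<in> - D"
      then show ?thesis using well_inside_Compl[OF D(1)] unfolding ev Collect_mem_eq by blast
    qed
  qed
qed

text \<open>Being Cauchy for the reflection means deciding every dichotomy. The maximality in
  \<open>completion_points\<close> is minimality of the family of members, as larger filters have
  fewer members. A minimal filter equals its round coarsening; conversely, if F is round and F' is a
  coarser Cauchy filter, then for each member of F some B in F lies well inside it, and F' cannot
  contain - B, so it contains that member.\<close>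

lemma point_iff:
  "F \<in> completion_points (finest_totally_bounded U) \<longleftrightarrow> F \<noteq> bot \<and>
     (\<forall>A B. well_inside U A B \<longrightarrow> (\<forall>\<^sub>F x in F. x \<in> B) \<or> (\<forall>\<^sub>F x in F. x \<in> - A)) \<and>
     (\<forall>A. (\<forall>\<^sub>F x in F. x \<in> A) \<longrightarrow> (\<exists>B. (\<forall>\<^sub>F x in F. x \<in> B) \<and> well_inside U B A))"
proof -
  let ?V = "totally_bounded_reflection U"
  define prox_cauchy where "prox_cauchy F \<longleftrightarrow>
     (\<forall>A B. well_inside U A B \<longrightarrow> (\<forall>\<^sub>F x in F. x \<in> B) \<or> (\<forall>\<^sub>F x in F. x \<in> - A))" for F
  have cauchy_iff: "uniform_space.cauchy_filter ?V F \<longleftrightarrow> prox_cauchy F" for F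
  proof -
    have "uniform_space.cauchy_filter ?V F \<longleftrightarrow> F \<times>\<^sub>F F \<le> ?V"
      by (rule uniform_space.cauchy_filter_def[OF is_uniformity_reflection[unfolded is_uniformity_def]])
    also have "\<dots> \<longleftrightarrow> (\<forall>A B. well_inside U A B \<longrightarrow>
        (\<forall>\<^sub>F p in F \<times>\<^sub>F F. p \<in> dichotomy_entourage A B))"
      unfolding totally_bounded_reflection_def le_INF_iff by (auto simp: le_principal)
    also have "\<dots> \<longleftrightarrow> prox_cauchy F"
      unfolding prox_cauchy_def
    proof (intro all_cong1 imp_cong refl)
      fix A B
      have "(\<forall>\<^sub>F p in F \<times>\<^sub>F F. p \<in> dichotomy_entourage A B) \<longleftrightarrow>
          (\<exists>C. (\<forall>\<^sub>F x in F. x \<in> C) \<and> C \<times> C \<subseteq> dichotomy_entourage A B)"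
      proof
        assume "\<forall>\<^sub>F p in F \<times>\<^sub>F F. p \<in> dichotomy_entourage A B"
        then obtain Q where "eventually Q F" "\<And>x y. Q x \<Longrightarrow> Q y \<Longrightarrow> (x, y) \<in> dichotomy_entourage A B"
          unfolding eventually_prod_same by blast
        then show "\<exists>C. (\<forall>\<^sub>F x in F. x \<in> C) \<and> C \<times> C \<subseteq> dichotomy_entourage A B"
          by (intro exI[of _ "Collect Q"]) auto
      qed (auto simp: eventually_prod_same)
      also have "\<dots> \<longleftrightarrow> (\<exists>C. (\<forall>\<^sub>F x in F. x \<in> C) \<and> (C \<subseteq> B \<or> C \<subseteq> - A))"
        unfolding square_subset_dichotomy_entourage ..
      also have "\<dots> \<longleftrightarrow> (\<forall>\<^sub>F x in F. x \<in> B) \<or> (\<forall>\<^sub>F x in F. x \<in> - A)"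
      proof
        assume "\<exists>C. (\<forall>\<^sub>F x in F. x \<in> C) \<and> (C \<subseteq> B \<or> C \<subseteq> - A)"
        then obtain C where "\<forall>\<^sub>F x in F. x \<in> C" "C \<subseteq> B \<or> C \<subseteq> - A" by blast
        then show "(\<forall>\<^sub>F x in F. x \<in> B) \<or> (\<forall>\<^sub>F x in F. x \<in> - A)"
          by (metis (no_types, lifting) eventually_mono subsetD)
      qed blast
      finally show "(\<forall>\<^sub>F p in F \<times>\<^sub>F F. p \<in> dichotomy_entourage A B) \<longleftrightarrow>
          (\<forall>\<^sub>F x in F. x \<in> B) \<or> (\<forall>\<^sub>F x in F. x \<in> - A)" .
    qed
    finally show ?thesis .
  qed
  have round_iff: "(\<forall>F'. F' \<noteq> bot \<and> prox_cauchy F' \<and> F \<le> F' \<longrightarrow> F' = F) \<longleftrightarrow>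
      (\<forall>A. (\<forall>\<^sub>F x in F. x \<in> A) \<longrightarrow> (\<exists>B. (\<forall>\<^sub>F x in F. x \<in> B) \<and> well_inside U B A))"
    if F: "F \<noteq> bot" "prox_cauchy F"
  proof (intro iffI allI impI; (elim conjE)?)
    fix A assume minimal: "\<forall>F'. F' \<noteq> bot \<and> prox_cauchy F' \<and> F \<le> F' \<longrightarrow> F' = F"
      and A: "\<forall>\<^sub>F x in F. x \<in> A"
    show "\<exists>B. (\<forall>\<^sub>F x in F. x \<in> B) \<and> well_inside U B A"
    proof (rule round_filter_above[OF F(1)])
      fix F' assume F': "F \<le> F'" "F' \<noteq> bot"
        "\<And>A B. well_inside U A B \<Longrightarrow> (\<forall>\<^sub>F x in F'. x \<in> B) \<or> (\<forall>\<^sub>F x in F'. x \<in> - A)"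
        "\<And>A. (\<forall>\<^sub>F x in F'. x \<in> A) \<Longrightarrow> \<exists>B. (\<forall>\<^sub>F x in F. x \<in> B) \<and> well_inside U B A"
      have "prox_cauchy F'"
        unfolding prox_cauchy_def using F'(3) by blast
      then have "F' = F" using minimal F'(1,2) by blast
      then show ?thesis
        using F'(4) A by blast
    qed (use F(2) in \<open>auto simp: prox_cauchy_def\<close>)
  next
    fix F' assume round: "\<forall>A. (\<forall>\<^sub>F x in F. x \<in> A) \<longrightarrow> (\<exists>B. (\<forall>\<^sub>F x in F. x \<in> B) \<and> well_inside U B A)"
      and F': "F' \<noteq> bot" "prox_cauchy F'" "F \<le> F'"
    have "F' \<le> F"
    proof (rule filter_leI)
      fix P assume "eventually P F"
      then obtain B where B: "\<forall>\<^sub>F x in F. x \<in> B" "well_inside U B (Collect P)"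
        using round[rule_format, of "Collect P"] by auto
      have "\<not> (\<forall>\<^sub>F x in F'. x \<in> - B)"
      proof
        assume "\<forall>\<^sub>F x in F'. x \<in> - B"
        from filter_leD[OF F'(3) this] B(1) have "\<forall>\<^sub>F x in F. False"
          by eventually_elim simp
        then show False using F(1) by simp
      qed
      then show "eventually P F'"
        using F'(2) B(2) unfolding prox_cauchy_def by fastforce
    qed
    then show "F' = F" using F'(3) by simp
  qed
  have "F \<in> completion_points (finest_totally_bounded U) \<longleftrightarrow>
      F \<noteq> bot \<and> prox_cauchy F \<and> (\<forall>F'. F' \<noteq> bot \<and> prox_cauchy F' \<and> F \<le> F' \<longrightarrow> F' = F)"
    by (simp only: completion_points_def finest_totally_bounded_eq mem_Collect_eq cauchy_iff)
  also have "\<dots> \<longleftrightarrow> F \<noteq> bot \<and> prox_cauchy F \<and>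
      (\<forall>A. (\<forall>\<^sub>F x in F. x \<in> A) \<longrightarrow> (\<exists>B. (\<forall>\<^sub>F x in F. x \<in> B) \<and> well_inside U B A))"
    by (intro conj_cong refl round_iff)
  finally show ?thesis
    unfolding prox_cauchy_def .
qed


lemma point_nonbot: "F \<in> completion_points (finest_totally_bounded U) \<Longrightarrow> F \<noteq> bot"
  and point_dichotomy: "F \<in> completion_points (finest_totally_bounded U) \<Longrightarrow>
    well_inside U A B \<Longrightarrow> (\<forall>\<^sub>F x in F. x \<in> B) \<or> (\<forall>\<^sub>F x in F. x \<in> - A)"
  and point_round: "F \<in> completion_points (finest_totally_bounded U) \<Longrightarrow>
    (\<forall>\<^sub>F x in F. x \<in> A) \<Longrightarrow> \<exists>B. (\<forall>\<^sub>F x in F. x \<in> B) \<and> well_inside U B A"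
  unfolding point_iff by blast+

section \<open>Topology of the completion: basic open sets, separation, compactness\<close>

definition basic_open :: "'a set \<Rightarrow> 'a filter set" where
  "basic_open A = {F \<in> completion_points (finest_totally_bounded U). \<forall>\<^sub>F x in F. x \<in> A}"

lemma mem_basic_openD:
  assumes "F \<in> basic_open A"
  shows "F \<in> completion_points (finest_totally_bounded U)" "\<forall>\<^sub>F x in F. x \<in> A"
  using assms unfolding basic_open_def by auto

lemma eventually_member_meets:
  assumes "F \<noteq> bot" "\<forall>\<^sub>F x in F. x \<in> A" "\<forall>\<^sub>F x in F. x \<in> B"
  shows "A \<inter> B \<noteq> {}"
proof
  assume "A \<inter> B = {}"
  from assms(2,3) have "\<forall>\<^sub>F x in F. False"
    by eventually_elim (use \<open>A \<inter> B = {}\<close> in auto)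
  then show False using assms(1) by simp
qed

text \<open>A point F is Cauchy, so it has a member whose square lies in a given entourage; filters
  sharing that member are close to F. Conversely, if A belongs to F, roundness gives B in F well
  inside A, and any filter close to F of order "x in B implies y in A" contains A.\<close>

lemma openin_completion_iff:
  "openin (completion_topology (finest_totally_bounded U)) W \<longleftrightarrow>
     W \<subseteq> completion_points (finest_totally_bounded U) \<and>
     (\<forall>F\<in>W. \<exists>A. (\<forall>\<^sub>F x in F. x \<in> A) \<and> basic_open A \<subseteq> W)"
proof -
  let ?V = "finest_totally_bounded U"
  have "(\<exists>E. eventually (\<lambda>p. p \<in> E) ?V \<and> completion_entourage ?V E `` {F} \<subseteq> W) \<longleftrightarrow>
      (\<exists>A. (\<forall>\<^sub>F x in F. x \<in> A) \<and> basic_open A \<subseteq> W)"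
    if F: "F \<in> completion_points ?V" for F
  proof
    assume "\<exists>E. eventually (\<lambda>p. p \<in> E) ?V \<and> completion_entourage ?V E `` {F} \<subseteq> W"
    then obtain E where E: "eventually (\<lambda>p. p \<in> E) ?V" "completion_entourage ?V E `` {F} \<subseteq> W"
      by blast
    have "F \<times>\<^sub>F F \<le> ?V"
      using F is_uniformity_reflection
      by (simp add: completion_points_def finest_totally_bounded_eq is_uniformity_def
          uniform_space.cauchy_filter_def)
    then have "eventually (\<lambda>p. p \<in> E) (F \<times>\<^sub>F F)"
      using E(1) by (rule filter_leD)
    then obtain Q where Q: "eventually Q F" "\<And>x y. Q x \<Longrightarrow> Q y \<Longrightarrow> (x, y) \<in> E"
      unfolding eventually_prod_same by blast
    have "basic_open (Collect Q) \<subseteq> completion_entourage ?V E `` {F}"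
    proof
      fix F' assume F': "F' \<in> basic_open (Collect Q)"
      have "\<exists>A. (\<forall>\<^sub>F x in F. x \<in> A) \<and> (\<forall>\<^sub>F x in F'. x \<in> A) \<and> A \<times> A \<subseteq> E"
        by (rule exI[of _ "Collect Q"]) (use Q mem_basic_openD(2)[OF F'] in auto)
      then show "F' \<in> completion_entourage ?V E `` {F}"
        using F mem_basic_openD(1)[OF F'] unfolding completion_entourage_def by simp
    qed
    then show "\<exists>A. (\<forall>\<^sub>F x in F. x \<in> A) \<and> basic_open A \<subseteq> W"
      by (intro exI[of _ "Collect Q"]) (use E(2) Q(1) in auto)
  next
    assume "\<exists>A. (\<forall>\<^sub>F x in F. x \<in> A) \<and> basic_open A \<subseteq> W"
    then obtain A where A: "\<forall>\<^sub>F x in F. x \<in> A" "basic_open A \<subseteq> W" by blast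
    obtain B where B: "\<forall>\<^sub>F x in F. x \<in> B" "well_inside U B A"
      using point_round[OF F A(1)] by blast
    define E where "E = {(x, y). x \<in> B \<longrightarrow> y \<in> A}"
    have "eventually (\<lambda>p. p \<in> E) ?V"
      using iffD2[OF well_inside_reflection B(2)]
      unfolding well_inside_def finest_totally_bounded_eq E_def by (simp add: case_prod_unfold)
    moreover have "completion_entourage ?V E `` {F} \<subseteq> W"
    proof
      fix F' assume "F' \<in> completion_entourage ?V E `` {F}"
      then obtain C where F': "F' \<in> completion_points ?V"
        and C: "\<forall>\<^sub>F x in F. x \<in> C" "\<forall>\<^sub>F x in F'. x \<in> C" "C \<times> C \<subseteq> E"
        unfolding completion_entourage_def by auto
      have "B \<inter> C \<noteq> {}"
        using point_nonbot[OF F] B(1) C(1) by (rule eventually_member_meets)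
      then have "C \<subseteq> A" using C(3) unfolding E_def by auto
      then have "\<forall>\<^sub>F x in F'. x \<in> A"
        using C(2) by (auto elim: eventually_mono)
      then show "F' \<in> W"
        using F' A(2) unfolding basic_open_def by auto
    qed
    ultimately show "\<exists>E. eventually (\<lambda>p. p \<in> E) ?V \<and> completion_entourage ?V E `` {F} \<subseteq> W"
      by blast
  qed
  then show ?thesis
    unfolding openin_completion_topology by (meson subsetD)
qed

lemma openin_basic_open: "openin (completion_topology (finest_totally_bounded U)) (basic_open A)"
  unfolding openin_completion_iff basic_open_def by auto

lemma topspace_completion:
  "topspace (completion_topology (finest_totally_bounded U)) =
     completion_points (finest_totally_bounded U)"
proof
  show "topspace (completion_topology (finest_totally_bounded U)) \<subseteq>
      completion_points (finest_totally_bounded U)"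
    using openin_topspace[of "completion_topology (finest_totally_bounded U)"]
    unfolding openin_completion_iff by blast
  show "completion_points (finest_totally_bounded U) \<subseteq>
      topspace (completion_topology (finest_totally_bounded U))"
    using openin_subset[OF openin_basic_open[of UNIV]] unfolding basic_open_def by simp
qed

lemma Hausdorff_completion: "Hausdorff_space (completion_topology (finest_totally_bounded U))"
  unfolding Hausdorff_space_def topspace_completion
proof (intro allI impI, elim conjE)
  fix F G assume F: "F \<in> completion_points (finest_totally_bounded U)"
    and G: "G \<in> completion_points (finest_totally_bounded U)" and "F \<noteq> G"
  \<comment> \<open>Points whose members always meet coincide: for B in G well inside a member of G,
    the filter F cannot contain - B, so by dichotomy it contains that member.\<close>
  have le: "F \<le> G" if F: "F \<in> completion_points (finest_totally_bounded U)"
    and G: "G \<in> completion_points (finest_totally_bounded U)"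
    and meets: "\<And>A B. (\<forall>\<^sub>F x in F. x \<in> A) \<Longrightarrow> (\<forall>\<^sub>F x in G. x \<in> B) \<Longrightarrow> A \<inter> B \<noteq> {}" for F G
  proof (rule filter_leI)
    fix P assume "eventually P G"
    then obtain B where B: "\<forall>\<^sub>F x in G. x \<in> B" "well_inside U B (Collect P)"
      using point_round[OF G, of "Collect P"] by auto
    have "\<not> (\<forall>\<^sub>F x in F. x \<in> - B)"
      using meets[of "- B" B] B(1) by auto
    then show "eventually P F"
      using point_dichotomy[OF F B(2)] by simp
  qed
  obtain A B where AB: "\<forall>\<^sub>F x in F. x \<in> A" "\<forall>\<^sub>F x in G. x \<in> B" "A \<inter> B = {}"
    using le[OF F G] le[OF G F] \<open>F \<noteq> G\<close> by (metis inf_commute order_antisym)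
  have "disjnt (basic_open A) (basic_open B)"
    using eventually_member_meets[of _ A B] AB(3) point_nonbot
    unfolding disjnt_iff basic_open_def by blast
  then show "\<exists>V W. openin (completion_topology (finest_totally_bounded U)) V \<and>
      openin (completion_topology (finest_totally_bounded U)) W \<and> F \<in> V \<and> G \<in> W \<and> disjnt V W"
    using F G AB(1,2)
    by (intro exI[of _ "basic_open A"] exI[of _ "basic_open B"])
      (simp add: openin_basic_open, simp add: basic_open_def)
qed

text \<open>
  If a cover has no finite subcover, then the sets lying well inside some B whose basic open set is
  contained in a member of the cover do not finitely cover the space. An ultrafilter containing all
  their complements is coarsened to a completion point, which no member of the cover contains.
\<close>

lemma compact_completion: "compact_space (completion_topology (finest_totally_bounded U))"
  unfolding compact_space_alt topspace_completion
proof (intro allI impI, elim conjE, rule ccontr)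
  let ?P = "completion_points (finest_totally_bounded U)"
  fix \<U> assume opn: "\<forall>W\<in>\<U>. openin (completion_topology (finest_totally_bounded U)) W"
    and cover: "?P \<subseteq> \<Union>\<U>" and bad: "\<not> (\<exists>\<F>. finite \<F> \<and> \<F> \<subseteq> \<U> \<and> ?P \<subseteq> \<Union>\<F>)"
  define \<A> where "\<A> = {A. \<exists>B W. well_inside U A B \<and> W \<in> \<U> \<and> basic_open B \<subseteq> W}"
  \<comment> \<open>If finitely many such sets covered the type, a point could not contain all their
    complements. By dichotomy it would contain one of the larger sets \<open>B A\<close> and hence
    lie in \<open>W A\<close>, giving a finite subcover.\<close>
  have no_cover: "\<Union>X \<noteq> UNIV" if X: "finite X" "X \<subseteq> \<A>" for X
  proof
    assume "\<Union>X = UNIV"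
    obtain B W where BW: "\<And>A. A \<in> X \<Longrightarrow> well_inside U A (B A)" "\<And>A. A \<in> X \<Longrightarrow> W A \<in> \<U>"
      "\<And>A. A \<in> X \<Longrightarrow> basic_open (B A) \<subseteq> W A"
      using X(2) unfolding \<A>_def subset_eq mem_Collect_eq by metis
    have "?P \<subseteq> \<Union>(W ` X)"
    proof
      fix F assume F: "F \<in> ?P"
      have "\<exists>A\<in>X. \<forall>\<^sub>F x in F. x \<in> B A"
      proof (rule ccontr)
        assume "\<not> (\<exists>A\<in>X. \<forall>\<^sub>F x in F. x \<in> B A)"
        then have "\<forall>A\<in>X. \<forall>\<^sub>F x in F. x \<in> - A"
          using point_dichotomy[OF F BW(1)] by blast
        with X(1) have "\<forall>\<^sub>F x in F. \<forall>A\<in>X. x \<in> - A"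
          by (rule eventually_ball_finite)
        then have "\<forall>\<^sub>F x in F. False"
          by (rule eventually_mono) (use \<open>\<Union>X = UNIV\<close> in blast)
        then show False using point_nonbot[OF F] by simp
      qed
      then show "F \<in> \<Union>(W ` X)"
        using BW(3) F unfolding basic_open_def by auto
    qed
    then show False
      using bad[unfolded not_ex, rule_format, of "W ` X"] X(1) BW(2) by blast
  qed
  have "(INF A\<in>\<A>. principal (- A)) \<noteq> bot"
  proof (rule INF_filter_not_bot)
    fix X assume "X \<subseteq> \<A>" "finite X"
    then have "(INF A\<in>X. principal (- A)) = principal (\<Inter>A\<in>X. - A)" "(\<Inter>A\<in>X. - A) \<noteq> {}"
      using no_cover[of X] by (simp_all add: INF_principal_finite) blast
    then show "(INF A\<in>X. principal (- A)) \<noteq> bot"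
      by (simp only: principal_eq_bot_iff) simp
  qed
  from ultrafilter_below[OF this]
  obtain G where G: "G \<le> (INF A\<in>\<A>. principal (- A))" "G \<noteq> bot"
    "\<And>A. (\<forall>\<^sub>F x in G. x \<in> A) \<or> (\<forall>\<^sub>F x in G. x \<in> - A)"
    by blast
  have G_dich: "(\<forall>\<^sub>F x in G. x \<in> B) \<or> (\<forall>\<^sub>F x in G. x \<in> - A)" if "well_inside U A B" for A B
    using G(3)[of A] well_inside_subset[OF that] by (auto elim: eventually_mono)
  show False
  proof (rule round_filter_above[OF G(2) G_dich])
    fix F assume F: "F \<noteq> bot"
      "\<And>A B. well_inside U A B \<Longrightarrow> (\<forall>\<^sub>F x in F. x \<in> B) \<or> (\<forall>\<^sub>F x in F. x \<in> - A)"
      "\<And>A. (\<forall>\<^sub>F x in F. x \<in> A) \<Longrightarrow> \<exists>B. (\<forall>\<^sub>F x in G. x \<in> B) \<and> well_inside U B A"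
      "\<And>A. (\<forall>\<^sub>F x in F. x \<in> A) \<Longrightarrow> \<exists>B. (\<forall>\<^sub>F x in F. x \<in> B) \<and> well_inside U B A"
    have "F \<in> ?P" unfolding point_iff using F(1,2,4) by blast
    then obtain W where W: "W \<in> \<U>" "F \<in> W" using cover by blast
    then obtain B where B: "\<forall>\<^sub>F x in F. x \<in> B" "basic_open B \<subseteq> W"
      using opn unfolding openin_completion_iff by blast
    obtain A where A: "\<forall>\<^sub>F x in G. x \<in> A" "well_inside U A B"
      using F(3)[OF B(1)] by blast
    have "A \<in> \<A>" unfolding \<A>_def using A(2) B(2) W(1) by blast
    then have "G \<le> principal (- A)"
      using G(1) by (meson INF_lower order_trans)
    then have "\<forall>\<^sub>F x in G. x \<in> - A" by (simp add: le_principal)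
    from eventually_member_meets[OF G(2) A(1) this] show False by simp
  qed
qed

section \<open>Extension of maps into compact Hausdorff spaces\<close>

lemma extension_to_completion:
  fixes f :: "'a \<Rightarrow> 'z"
  assumes Z: "compact_space Z" "Hausdorff_space Z" and f: "range f \<subseteq> topspace Z"
    and prox: "\<And>C W. closedin Z C \<Longrightarrow> openin Z W \<Longrightarrow> C \<subseteq> W \<Longrightarrow> well_inside U (f -` C) (f -` W)"
  obtains g where "continuous_map (completion_topology (finest_totally_bounded U)) Z g"
    "\<And>F z. F \<in> completion_points (finest_totally_bounded U) \<Longrightarrow> limitin Z f z F \<Longrightarrow> g F = z"
proof -
  let ?P = "completion_points (finest_totally_bounded U)"
  have regular: "\<exists>V C. openin Z V \<and> closedin Z C \<and> z \<in> V \<and> V \<subseteq> C \<and> C \<subseteq> W"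
    if "openin Z W" "z \<in> W" for z W
    using compact_Hausdorff_imp_regular_space[OF Z] that
    unfolding neighbourhood_base_of_closedin[symmetric] neighbourhood_base_of by blast
  have limit: "\<exists>z. limitin Z f z F" if F: "F \<in> ?P" for F
  proof -
    \<comment> \<open>Compactness gives a cluster point of \<open>f\<close> along F: otherwise
      finitely many open sets that \<open>f\<close> eventually avoids would cover
      \<open>Z\<close>.\<close>
    have "\<exists>z\<in>topspace Z. \<forall>W. openin Z W \<and> z \<in> W \<longrightarrow> \<not> (\<forall>\<^sub>F x in F. f x \<notin> W)"
    proof (rule ccontr)
      assume "\<not> ?thesis"
      then have "topspace Z \<subseteq> \<Union>{W. openin Z W \<and> (\<forall>\<^sub>F x in F. f x \<notin> W)}"
        by blast
      then obtain \<F> where \<F>: "finite \<F>" "\<F> \<subseteq> {W. openin Z W \<and> (\<forall>\<^sub>F x in F. f x \<notin> W)}"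
        "topspace Z \<subseteq> \<Union>\<F>"
        using Z(1) unfolding compact_space_alt
        by (metis (no_types, lifting) mem_Collect_eq)
      have "\<forall>\<^sub>F x in F. \<forall>W\<in>\<F>. f x \<notin> W"
        using \<F>(1,2) by (intro eventually_ball_finite) auto
      moreover have "\<not> (\<forall>W\<in>\<F>. f x \<notin> W)" for x
        using \<F>(3) f by blast
      ultimately have "\<forall>\<^sub>F x in F. False" by simp
      then show False using point_nonbot[OF F] by simp
    qed
    then obtain z where z: "z \<in> topspace Z"
      "\<And>W. openin Z W \<Longrightarrow> z \<in> W \<Longrightarrow> \<not> (\<forall>\<^sub>F x in F. f x \<notin> W)" by blast
    have "\<forall>\<^sub>F x in F. f x \<in> W" if W: "openin Z W" "z \<in> W" for W
    proof -
      \<comment> \<open>A closed neighbourhood C of z inside W turns the cluster point into a limit.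
        As \<open>f\<close> does not eventually avoid V, it does not eventually avoid C, and the
        dichotomy that \<open>prox\<close> provides for C and W leaves the preimage of W.\<close>
      obtain V C where VC: "openin Z V" "closedin Z C" "z \<in> V" "V \<subseteq> C" "C \<subseteq> W"
        using regular[OF W] by blast
      have "\<not> (\<forall>\<^sub>F x in F. x \<in> - (f -` C))"
      proof
        assume "\<forall>\<^sub>F x in F. x \<in> - (f -` C)"
        then have "\<forall>\<^sub>F x in F. f x \<notin> V"
          by (rule eventually_mono) (use VC(4) in auto)
        then show False using z(2) VC by blast
      qed
      then show ?thesis
        using point_dichotomy[OF F prox[OF VC(2) W(1) VC(5)]] by simp
    qed
    then show ?thesis using z(1) unfolding limitin_def by blast
  qed
  \<comment> \<open>The choice is meaningful only at points of the completion, where a limit exists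
    and is unique.\<close>
  define g where "g F = (SOME z. limitin Z f z F)" for F
  have g: "limitin Z f (g F) F" if "F \<in> ?P" for F
    unfolding g_def using limit[OF that] by (rule someI_ex)
  show ?thesis
  proof
    show "g F = z" if "F \<in> ?P" "limitin Z f z F" for F z
      using g[OF that(1)] that(2) point_nonbot[OF that(1)] Z(2)
      by (rule limitin_Hausdorff_unique)
    show "continuous_map (completion_topology (finest_totally_bounded U)) Z g"
      unfolding continuous_map_def topspace_completion
    proof (intro conjI allI impI)
      show "g \<in> ?P \<rightarrow> topspace Z"
        using g by (auto simp: limitin_def)
      fix W assume W: "openin Z W"
      show "openin (completion_topology (finest_totally_bounded U)) {F \<in> ?P. g F \<in> W}"
        unfolding openin_completion_iff
      proof (intro conjI ballI)
        fix F assume "F \<in> {F \<in> ?P. g F \<in> W}"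
        then have F: "F \<in> ?P" "g F \<in> W" by auto
        obtain V C where VC: "openin Z V" "closedin Z C" "g F \<in> V" "V \<subseteq> C" "C \<subseteq> W"
          using regular[OF W F(2)] by blast
        \<comment> \<open>Limits along filters that contain the preimage of V can leave V but not
          the closed set C, which still lies in W.\<close>
        have "basic_open (f -` V) \<subseteq> {F \<in> ?P. g F \<in> W}"
        proof
          fix G assume G: "G \<in> basic_open (f -` V)"
          have lim: "limitin Z f (g G) G"
            using g[OF mem_basic_openD(1)[OF G]] .
          have "g G \<in> C"
          proof (rule ccontr)
            assume "g G \<notin> C"
            then have "g G \<in> topspace Z - C"
              using limitin_topspace[OF lim] by blast
            moreover have "openin Z (topspace Z - C)"
              using VC(2) by (simp add: closedin_def)
            ultimately have "\<forall>\<^sub>F x in G. f x \<in> topspace Z - C"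
              using lim unfolding limitin_def by blast
            then have "\<forall>\<^sub>F x in G. x \<in> f -` (topspace Z - C)"
              by simp
            from eventually_member_meets[OF point_nonbot[OF mem_basic_openD(1)[OF G]]
                mem_basic_openD(2)[OF G] this]
            show False using VC(4) by blast
          qed
          then show "G \<in> {F \<in> ?P. g F \<in> W}"
            using VC(5) mem_basic_openD(1)[OF G] by blast
        qed
        moreover have "\<forall>\<^sub>F x in F. x \<in> f -` V"
          using g[OF F(1)] VC(1,3) by (simp add: limitin_def)
        ultimately show "\<exists>A. (\<forall>\<^sub>F x in F. x \<in> A) \<and> basic_open A \<subseteq> {F \<in> ?P. g F \<in> W}"
          by blast
      qed auto
    qed
  qed
qed


text \<open>The clause on preimages makes direct images of points decide dichotomies; the clause on
  images makes them round.\<close>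

definition proximal_automorphism :: "('a \<Rightarrow> 'a) \<Rightarrow> bool" where
  "proximal_automorphism \<tau> \<longleftrightarrow> (\<forall>A B. well_inside U A B \<longrightarrow>
     well_inside U (\<tau> -` A) (\<tau> -` B) \<and> well_inside U (\<tau> ` A) (\<tau> ` B))"

lemma filtermap_point:
  assumes \<tau>: "proximal_automorphism \<tau>" and F: "F \<in> completion_points (finest_totally_bounded U)"
  shows "filtermap \<tau> F \<in> completion_points (finest_totally_bounded U)"
  unfolding point_iff
proof (intro conjI allI impI)
  show "filtermap \<tau> F \<noteq> bot"
    using point_nonbot[OF F] by (simp add: filtermap_bot_iff)
  show "(\<forall>\<^sub>F x in filtermap \<tau> F. x \<in> B) \<or> (\<forall>\<^sub>F x in filtermap \<tau> F. x \<in> - A)"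
    if "well_inside U A B" for A B
  proof -
    have "well_inside U (\<tau> -` A) (\<tau> -` B)"
      using \<tau> that unfolding proximal_automorphism_def by blast
    from point_dichotomy[OF F this] show ?thesis
      by (simp add: eventually_filtermap)
  qed
  show "\<exists>B. (\<forall>\<^sub>F x in filtermap \<tau> F. x \<in> B) \<and> well_inside U B A"
    if "\<forall>\<^sub>F x in filtermap \<tau> F. x \<in> A" for A
  proof -
    have "\<forall>\<^sub>F x in F. x \<in> \<tau> -` A"
      using that by (simp add: eventually_filtermap)
    from point_round[OF F this] obtain B where B: "\<forall>\<^sub>F x in F. x \<in> B" "well_inside U B (\<tau> -` A)"
      by blast
    have "well_inside U (\<tau> ` B) (\<tau> ` (\<tau> -` A))"
      using \<tau> B(2) unfolding proximal_automorphism_def by blast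
    then have "well_inside U (\<tau> ` B) A"
      by (rule well_inside_mono) auto
    moreover have "\<forall>\<^sub>F x in filtermap \<tau> F. x \<in> \<tau> ` B"
      unfolding eventually_filtermap using B(1) by (rule eventually_mono) auto
    ultimately show ?thesis by blast
  qed
qed

lemma continuous_map_filtermap:
  assumes \<tau>: "proximal_automorphism \<tau>"
  shows "continuous_map (completion_topology (finest_totally_bounded U))
    (completion_topology (finest_totally_bounded U)) (filtermap \<tau>)"
  unfolding continuous_map_def topspace_completion
proof (intro conjI allI impI)
  let ?P = "completion_points (finest_totally_bounded U)"
  show "filtermap \<tau> \<in> ?P \<rightarrow> ?P"
    using filtermap_point[OF \<tau>] by blast
  fix W assume W: "openin (completion_topology (finest_totally_bounded U)) W"
  show "openin (completion_topology (finest_totally_bounded U)) {F \<in> ?P. filtermap \<tau> F \<in> W}"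
    unfolding openin_completion_iff
  proof (intro conjI ballI)
    fix F assume "F \<in> {F \<in> ?P. filtermap \<tau> F \<in> W}"
    then obtain A where A: "\<forall>\<^sub>F x in filtermap \<tau> F. x \<in> A" "basic_open A \<subseteq> W"
      using W unfolding openin_completion_iff by blast
    have "basic_open (\<tau> -` A) \<subseteq> {F \<in> ?P. filtermap \<tau> F \<in> W}"
      using A(2) filtermap_point[OF \<tau>] unfolding basic_open_def
      by (auto simp: eventually_filtermap)
    moreover have "\<forall>\<^sub>F x in F. x \<in> \<tau> -` A"
      using A(1) by (simp add: eventually_filtermap)
    ultimately show "\<exists>A. (\<forall>\<^sub>F x in F. x \<in> A) \<and> basic_open A \<subseteq> {F \<in> ?P. filtermap \<tau> F \<in> W}"
      by blast
  qed auto
qed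

end

section \<open>The canonical map for a uniformity that induces a given Hausdorff topology\<close>

locale compatible_uniformity = uniform_structure U
  for U :: "('a::t2_space \<times> 'a) filter" +
  assumes eventually_nhds_iff: "eventually P (nhds x) \<longleftrightarrow> well_inside U {x} (Collect P)"
begin

text \<open>The reflection has the same proximity as \<open>U\<close>, hence the same neighbourhoods
  of points, so the canonical map needs no reference to the reflection.\<close>

lemma completion_map_eq_nhds: "completion_map (finest_totally_bounded U) = nhds"
proof
  fix x
  have "eventually P (filtercomap (\<lambda>y. (x, y)) (finest_totally_bounded U)) \<longleftrightarrow>
      eventually P (nhds x)" for P
  proof -
    have "eventually P (nhds x) \<longleftrightarrow> well_inside (finest_totally_bounded U) {x} (Collect P)"
      unfolding eventually_nhds_iff finest_totally_bounded_eq well_inside_reflection ..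
    also have "\<dots> \<longleftrightarrow> (\<exists>Q. eventually Q (finest_totally_bounded U) \<and> (\<forall>y. Q (x, y) \<longrightarrow> P y))"
      unfolding well_inside_def
    proof
      assume "\<forall>\<^sub>F (x', y) in finest_totally_bounded U. x' \<in> {x} \<longrightarrow> y \<in> Collect P"
      then show "\<exists>Q. eventually Q (finest_totally_bounded U) \<and> (\<forall>y. Q (x, y) \<longrightarrow> P y)"
        by (intro exI conjI) (assumption, simp)
    next
      assume "\<exists>Q. eventually Q (finest_totally_bounded U) \<and> (\<forall>y. Q (x, y) \<longrightarrow> P y)"
      then show "\<forall>\<^sub>F (x', y) in finest_totally_bounded U. x' \<in> {x} \<longrightarrow> y \<in> Collect P"
        by (auto elim: eventually_mono)
    qed
    finally show ?thesis unfolding eventually_filtercomap by blast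
  qed
  then show "completion_map (finest_totally_bounded U) x = nhds x"
    unfolding completion_map_def by (simp add: filter_eq_iff)
qed

lemma nhds_point: "nhds x \<in> completion_points (finest_totally_bounded U)"
  unfolding point_iff
proof (intro conjI allI impI)
  show "(\<forall>\<^sub>F y in nhds x. y \<in> B) \<or> (\<forall>\<^sub>F y in nhds x. y \<in> - A)" if AB: "well_inside U A B" for A B
  proof -
    \<comment> \<open>Membership of x in the interpolant decides: C is well inside B, and - C is
      well inside - A.\<close>
    obtain C where C: "well_inside U A C" "well_inside U C B"
      using AB by (rule well_inside_interpolate)
    show ?thesis
    proof (cases "x \<in> C")
      case True
      then show ?thesis
        using well_inside_mono[OF C(2), of "{x}" B] by (simp add: eventually_nhds_iff)
    next
      case False
      then show ?thesis
        using well_inside_mono[OF well_inside_Compl[OF C(1)], of "{x}" "- A"]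
        by (simp add: eventually_nhds_iff Compl_eq)
    qed
  qed
  show "\<exists>B. (\<forall>\<^sub>F y in nhds x. y \<in> B) \<and> well_inside U B A" if "\<forall>\<^sub>F y in nhds x. y \<in> A" for A
  proof -
    have "well_inside U {x} A" using that by (simp add: eventually_nhds_iff)
    then obtain C where "well_inside U {x} C" "well_inside U C A"
      by (rule well_inside_interpolate)
    then show ?thesis by (auto simp: eventually_nhds_iff)
  qed
qed simp

text \<open>Both the continuity of \<open>nhds\<close> and its openness onto its range are read off
  from this.\<close>

lemma nhds_in_basic_open_iff: "nhds x \<in> basic_open A \<longleftrightarrow> x \<in> interior A"
  unfolding basic_open_def using nhds_point by (auto simp: interior_def eventually_nhds)

lemma is_compactification_completion:
  "is_compactification (completion_topology (finest_totally_bounded U))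
     (completion_map (finest_totally_bounded U))"
  unfolding is_compactification_def completion_map_eq_nhds
proof (intro conjI compact_completion Hausdorff_completion)
  let ?P = "completion_points (finest_totally_bounded U)"
  let ?Y = "completion_topology (finest_totally_bounded U)"
  have "embedding_map euclidean (subtopology ?Y (range nhds)) nhds"
  proof (rule injective_open_imp_embedding_map)
    have "continuous_map euclidean ?Y nhds"
      unfolding continuous_map_def topspace_completion
    proof (intro conjI allI impI)
      fix W assume W: "openin ?Y W"
      have "open {x. nhds x \<in> W}"
      proof (subst open_subopen, clarify)
        fix x assume "nhds x \<in> W"
        then obtain A where A: "\<forall>\<^sub>F y in nhds x. y \<in> A" "basic_open A \<subseteq> W"
          using W unfolding openin_completion_iff by blast
        have "x \<in> interior A"
          using A(1) nhds_point unfolding nhds_in_basic_open_iff[symmetric] basic_open_def by blast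
        then show "\<exists>T. open T \<and> x \<in> T \<and> T \<subseteq> {x. nhds x \<in> W}"
          using A(2) nhds_in_basic_open_iff by (intro exI[of _ "interior A"]) auto
      qed
      then show "openin euclidean {x \<in> topspace euclidean. nhds x \<in> W}" by simp
    qed (use nhds_point in auto)
    then show "continuous_map euclidean (subtopology ?Y (range nhds)) nhds"
      by (simp add: continuous_map_in_subtopology)
    show "open_map euclidean (subtopology ?Y (range nhds)) nhds"
      unfolding open_map_def
    proof (intro allI impI)
      fix S :: "'a set" assume "openin euclidean S"
      then have "nhds ` S = basic_open S \<inter> range nhds"
        using nhds_in_basic_open_iff[of _ S] by (auto simp: interior_open)
      then show "openin (subtopology ?Y (range nhds)) (nhds ` S)"
        using openin_basic_open unfolding openin_subtopology by blast
    qed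
    show "inj_on nhds (topspace (euclidean :: 'a topology))"
    proof (rule inj_onI)
      fix x y :: 'a assume eq: "nhds x = nhds y"
      show "x = y"
      proof (rule ccontr)
        assume "x \<noteq> y"
        then obtain S where S: "open S" "x \<in> S" "y \<notin> S"
          using separation_t1 by blast
        then have "\<forall>\<^sub>F z in nhds y. z \<in> S"
          unfolding eq[symmetric] by (simp add: eventually_nhds_in_open)
        then show False using S(3) eventually_nhds_x_imp_x by fast
      qed
    qed
  qed
  then show "embedding_map euclidean ?Y nhds"
    by (simp add: embedding_map_in_subtopology)
  show "?Y closure_of range nhds = topspace ?Y"
    unfolding dense_intersects_open
  proof (intro allI impI, elim conjE)
    fix W assume W: "openin ?Y W" "W \<noteq> {}"
    then obtain F A where F: "F \<in> W" "\<forall>\<^sub>F x in F. x \<in> A" "basic_open A \<subseteq> W"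
      unfolding openin_completion_iff by blast
    have FP: "F \<in> ?P" using F(1) W(1) unfolding openin_completion_iff by blast
    \<comment> \<open>Density from roundness: A is a neighbourhood of every x in B, so
      \<open>nhds x\<close> lies in \<open>basic_open A\<close>.\<close>
    obtain B where B: "\<forall>\<^sub>F x in F. x \<in> B" "well_inside U B A"
      using point_round[OF FP F(2)] by blast
    obtain x where "x \<in> B"
      using eventually_member_meets[OF point_nonbot[OF FP] B(1) B(1)] by blast
    then have "well_inside U {x} A"
      using B(2) by (auto intro: well_inside_mono)
    then have "nhds x \<in> basic_open A"
      unfolding basic_open_def using nhds_point by (simp add: eventually_nhds_iff)
    then show "range nhds \<inter> W \<noteq> {}" using F(3) by blast
  qed
qed

lemma compactification_le_completion:
  fixes f :: "'a \<Rightarrow> 'z"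
  assumes Z: "compact_space Z" "Hausdorff_space Z" and f: "range f \<subseteq> topspace Z"
    and prox: "\<And>C W. closedin Z C \<Longrightarrow> openin Z W \<Longrightarrow> C \<subseteq> W \<Longrightarrow> well_inside U (f -` C) (f -` W)"
  shows "compactification_le Z f (completion_topology (finest_totally_bounded U))
    (completion_map (finest_totally_bounded U))"
proof (rule extension_to_completion[OF Z f prox])
  fix g assume g: "continuous_map (completion_topology (finest_totally_bounded U)) Z g"
    "\<And>F z. F \<in> completion_points (finest_totally_bounded U) \<Longrightarrow> limitin Z f z F \<Longrightarrow> g F = z"
  \<comment> \<open>Singletons of \<open>Z\<close> are closed, so \<open>prox\<close> for the closed
    set {f x} inside W is continuity of \<open>f\<close> at x. The extension therefore takes the
    value f x at \<open>nhds x\<close>.\<close>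
  have lim: "limitin Z f (f x) (nhds x)" for x
    unfolding limitin_def
  proof (intro conjI allI impI; (elim conjE)?)
    show "f x \<in> topspace Z" using f by blast
    then have "closedin Z {f x}"
      using Z(2) by (simp add: closedin_Hausdorff_singleton)
    moreover fix W assume "openin Z W" "f x \<in> W"
    ultimately have "well_inside U (f -` {f x}) (f -` W)"
      by (intro prox) auto
    then have "well_inside U {x} (f -` W)"
      by (rule well_inside_mono) auto
    then show "\<forall>\<^sub>F y in nhds x. f y \<in> W"
      unfolding eventually_nhds_iff by (simp add: vimage_def)
  qed
  have "f = g \<circ> completion_map (finest_totally_bounded U)"
    unfolding completion_map_eq_nhds by (intro ext) (simp add: g(2)[OF nhds_point lim])
  then show ?thesis
    unfolding compactification_le_def using g(1) by blast
qed

text \<open>The two inclusions are continuity and openness at x, coming from the preimage and the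
  image clause respectively.\<close>

lemma filtermap_nhds:
  assumes "proximal_automorphism \<tau>"
  shows "filtermap \<tau> (nhds x) = nhds (\<tau> x)"
proof (rule antisym; rule filter_leI)
  fix P assume "eventually P (nhds (\<tau> x))"
  then have "well_inside U (\<tau> -` {\<tau> x}) (\<tau> -` Collect P)"
    using assms unfolding eventually_nhds_iff proximal_automorphism_def by blast
  then have "well_inside U {x} (\<tau> -` Collect P)"
    by (rule well_inside_mono) auto
  then show "eventually P (filtermap \<tau> (nhds x))"
    unfolding eventually_filtermap eventually_nhds_iff by (simp add: vimage_def)
next
  fix P assume "eventually P (filtermap \<tau> (nhds x))"
  then have "well_inside U (\<tau> ` {x}) (\<tau> ` {y. P (\<tau> y)})"
    using assms unfolding eventually_filtermap eventually_nhds_iff proximal_automorphism_def by blast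
  then show "eventually P (nhds (\<tau> x))"
    unfolding eventually_nhds_iff by (rule well_inside_mono) auto
qed

end

section \<open>The Roelcke uniformity\<close>

text \<open>The cover of an intersection of two neighbourhoods refines both covers, so the
  entourages of single covers already form a base.\<close>

lemma eventually_roelcke_uniformity:
  "eventually P roelcke_uniformity \<longleftrightarrow> (\<exists>N. open N \<and> 0 \<in> N \<and>
     (\<forall>g. \<forall>u\<in>N. \<forall>v\<in>N. \<forall>u'\<in>N. \<forall>v'\<in>N. P (u + g + v, u' + g + v')))"
proof -
  let ?\<C> = "{roelcke_cover N | N. open N \<and> (0::'a) \<in> N}"
  have "eventually P roelcke_uniformity \<longleftrightarrow> (\<exists>C\<in>?\<C>. eventually P (principal (\<Union>A\<in>C. A \<times> A)))"
    unfolding roelcke_uniformity_def uniformity_of_covers_def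
  proof (rule eventually_INF_base)
    show "?\<C> \<noteq> {}" using open_UNIV by blast
    fix C D assume "C \<in> ?\<C>" "D \<in> ?\<C>"
    then obtain M N where MN: "open M" "0 \<in> M" "open N" "0 \<in> N"
      "C = roelcke_cover M" "D = roelcke_cover N" by blast
    show "\<exists>E\<in>?\<C>. principal (\<Union>A\<in>E. A \<times> A) \<le> inf (principal (\<Union>A\<in>C. A \<times> A)) (principal (\<Union>A\<in>D. A \<times> A))"
    proof (rule bexI[of _ "roelcke_cover (M \<inter> N)"])
      show "roelcke_cover (M \<inter> N) \<in> ?\<C>" using MN open_Int by blast
      show "principal (\<Union>A\<in>roelcke_cover (M \<inter> N). A \<times> A) \<le>
          inf (principal (\<Union>A\<in>C. A \<times> A)) (principal (\<Union>A\<in>D. A \<times> A))"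
        unfolding MN(5,6) roelcke_cover_def by (simp, blast)
    qed
  qed
  also have "\<dots> \<longleftrightarrow> (\<exists>N. open N \<and> 0 \<in> N \<and> eventually P (principal (\<Union>A\<in>roelcke_cover N. A \<times> A)))"
    by blast
  also have "\<dots> \<longleftrightarrow> (\<exists>N. open N \<and> 0 \<in> N \<and>
      (\<forall>g. \<forall>u\<in>N. \<forall>v\<in>N. \<forall>u'\<in>N. \<forall>v'\<in>N. P (u + g + v, u' + g + v')))"
    unfolding roelcke_cover_def eventually_principal by (intro ex_cong1 conj_cong refl) blast
  finally show ?thesis .
qed

lemma symmetric_neighbourhood:
  fixes N :: "'a::topological_group_add set"
  assumes "open N" "0 \<in> N"
  obtains M where "open M" "0 \<in> M" "M \<subseteq> N" "\<And>u. u \<in> M \<Longrightarrow> - u \<in> M" "\<And>u v. u \<in> M \<Longrightarrow> v \<in> M \<Longrightarrow> u + v \<in> N"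
proof -
  have "open ((\<lambda>p::'a \<times> 'a. fst p + snd p) -` N)"
    using assms(1) by (intro open_vimage continuous_intros)
  then obtain A B where AB: "open A" "open B" "(0, 0) \<in> A \<times> B"
    "A \<times> B \<subseteq> (\<lambda>p::'a \<times> 'a. fst p + snd p) -` N"
    by (rule open_prod_elim[of _ "(0, 0)"]) (use assms(2) in auto)
  define C where "C = A \<inter> B \<inter> N"
  define M where "M = C \<inter> uminus -` C"
  show ?thesis
  proof
    show "open M" unfolding M_def C_def using AB(1,2) assms(1)
      by (intro open_Int open_vimage continuous_intros)
    show "u + v \<in> N" if "u \<in> M" "v \<in> M" for u v
    proof -
      have "(u, v) \<in> A \<times> B" using that unfolding M_def C_def by auto
      then show ?thesis using AB(4) by auto
    qed
  qed (use AB(3) assms(2) in \<open>auto simp: M_def C_def\<close>)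
qed

lemma well_inside_roelcke_iff:
  "well_inside roelcke_uniformity A B \<longleftrightarrow>
     (\<exists>N. open N \<and> 0 \<in> N \<and> (\<forall>x\<in>A. \<forall>u\<in>N. \<forall>v\<in>N. u + x + v \<in> B))"
proof
  assume "well_inside roelcke_uniformity A B"
  then obtain N where N: "open N" "0 \<in> N"
    and *: "\<And>g u v u' v'. u \<in> N \<Longrightarrow> v \<in> N \<Longrightarrow> u' \<in> N \<Longrightarrow> v' \<in> N \<Longrightarrow>
      u + g + v \<in> A \<Longrightarrow> u' + g + v' \<in> B"
    unfolding well_inside_def eventually_roelcke_uniformity by auto
  have "\<forall>x\<in>A. \<forall>u\<in>N. \<forall>v\<in>N. u + x + v \<in> B"
    using *[OF N(2) N(2)] by simp
  then show "\<exists>N. open N \<and> 0 \<in> N \<and> (\<forall>x\<in>A. \<forall>u\<in>N. \<forall>v\<in>N. u + x + v \<in> B)"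
    using N by blast
next
  assume "\<exists>N. open N \<and> 0 \<in> N \<and> (\<forall>x\<in>A. \<forall>u\<in>N. \<forall>v\<in>N. u + x + v \<in> B)"
  then obtain N where N: "open N" "0 \<in> N" "\<And>x u v. x \<in> A \<Longrightarrow> u \<in> N \<Longrightarrow> v \<in> N \<Longrightarrow> u + x + v \<in> B"
    by blast
  obtain M where M: "open M" "0 \<in> M" "\<And>u. u \<in> M \<Longrightarrow> - u \<in> M"
    "\<And>u v. u \<in> M \<Longrightarrow> v \<in> M \<Longrightarrow> u + v \<in> N"
    using symmetric_neighbourhood[OF N(1,2)] by metis
  have "u' + g + v' \<in> B"
    if "u \<in> M" "v \<in> M" "u' \<in> M" "v' \<in> M" "u + g + v \<in> A" for g u v u' v'
  proof -
    \<comment> \<open>The centre g is eliminated: u' + g + v' arises from the element u + g + v of A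
      by adding u' - u on the left and - v + v' on the right, both in N by the choice of M.\<close>
    have "(u' + - u) + (u + g + v) + (- v + v') \<in> B"
      using that M(3,4) by (intro N(3)) (simp_all del: add_uminus_conv_diff)
    then show ?thesis by (simp add: add.assoc del: add_uminus_conv_diff)
  qed
  then show "well_inside roelcke_uniformity A B"
    unfolding well_inside_def eventually_roelcke_uniformity using M(1,2) by auto
qed

lemma is_uniformity_roelcke: "is_uniformity roelcke_uniformity"
  unfolding is_uniformity_iff
proof (intro conjI allI impI)
  fix E :: "'a \<times> 'a \<Rightarrow> bool" assume "eventually E roelcke_uniformity"
  then obtain N where N: "open N" "0 \<in> N"
    and E': "\<forall>g. \<forall>u\<in>N. \<forall>v\<in>N. \<forall>u'\<in>N. \<forall>v'\<in>N. E (u + g + v, u' + g + v')"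
    unfolding eventually_roelcke_uniformity by (elim exE conjE)
  have E: "E (u + g + v, u' + g + v')" if "u \<in> N" "v \<in> N" "u' \<in> N" "v' \<in> N" for g u v u' v'
    using E' that by (elim allE ballE) auto
  show "E (x, x)" for x
    using E[OF N(2) N(2) N(2) N(2), of x] by simp
  show "eventually (\<lambda>(x, y). E (y, x)) roelcke_uniformity"
    unfolding eventually_roelcke_uniformity using N E by (intro exI[of _ N]) auto
  obtain M' where M': "open M'" "0 \<in> M'" "\<And>u v. u \<in> M' \<Longrightarrow> v \<in> M' \<Longrightarrow> u + v \<in> N"
    using symmetric_neighbourhood[OF N] by metis
  obtain M where M: "open M" "0 \<in> M" "M \<subseteq> M'" "\<And>u. u \<in> M \<Longrightarrow> - u \<in> M"
    "\<And>u v. u \<in> M \<Longrightarrow> v \<in> M \<Longrightarrow> u + v \<in> M'"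
    using symmetric_neighbourhood[OF M'(1,2)] by metis
  define D where "D p \<longleftrightarrow> (\<exists>g. \<exists>u\<in>M. \<exists>v\<in>M. \<exists>u'\<in>M. \<exists>v'\<in>M. p = (u + g + v, u' + g + v'))" for p
  have "D (u + g + v, u' + g + v')" if "u \<in> M" "v \<in> M" "u' \<in> M" "v' \<in> M" for g u v u' v'
    unfolding D_def
    by (intro exI[of _ g] bexI[of _ u] bexI[of _ v] bexI[of _ u'] bexI[of _ v'] refl that)
  then have "eventually D roelcke_uniformity"
    unfolding eventually_roelcke_uniformity
    by (intro exI[of _ M] conjI allI ballI) (use M(1,2) in auto)
  moreover have "E (x, z)" if "D (x, y)" "D (y, z)" for x y z
  proof -
    obtain g u1 v1 u2 v2 where g: "u1 \<in> M" "v1 \<in> M" "u2 \<in> M" "v2 \<in> M"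
      "x = u1 + g + v1" "y = u2 + g + v2"
      using \<open>D (x, y)\<close> unfolding D_def by blast
    obtain h u3 v3 u4 v4 where h: "u3 \<in> M" "v3 \<in> M" "u4 \<in> M" "v4 \<in> M"
      "y = u3 + h + v3" "z = u4 + h + v4"
      using \<open>D (y, z)\<close> unfolding D_def by blast
    \<comment> \<open>Solving for the second centre h expresses z through the first centre g. Three
      elements of M then accumulate on each side, which is why N was halved twice.\<close>
    have h_eq: "h = - u3 + (u2 + g + v2) + - v3"
      unfolding g(6)[symmetric] h(5) by (simp add: add.assoc)
    have z: "z = (u4 + - u3 + u2) + g + (v2 + (- v3 + v4))"
      unfolding h(6) h_eq by (simp add: add.assoc del: add_uminus_conv_diff)
    have "u1 \<in> N" "v1 \<in> N"
      using M'(3)[of u1 0] M'(3)[of v1 0] M(3) M'(2) g(1,2) by auto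
    moreover have "u4 + - u3 + u2 \<in> N" "v2 + (- v3 + v4) \<in> N"
      using g h M by (auto intro!: M'(3) simp del: add_uminus_conv_diff)
    ultimately show "E (x, z)"
      unfolding z g(5) by (rule E)
  qed
  ultimately show "\<exists>D. eventually D roelcke_uniformity \<and>
      (\<forall>x y z. D (x, y) \<longrightarrow> D (y, z) \<longrightarrow> E (x, z))"
    by blast
qed

text \<open>This is the compatibility assumption of \<open>compatible_uniformity\<close>. One
  direction is continuity of u + x + v in (u, v) at (0, 0); the other takes v = 0 and uses the
  translate N + x.\<close>

lemma eventually_nhds_iff_roelcke:
  fixes x :: "'a::topological_group_add"
  shows "eventually P (nhds x) \<longleftrightarrow> well_inside roelcke_uniformity {x} (Collect P)"
proof
  assume "eventually P (nhds x)"
  then obtain S where S: "open S" "x \<in> S" "\<And>y. y \<in> S \<Longrightarrow> P y"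
    unfolding eventually_nhds by blast
  have "open ((\<lambda>p. fst p + x + snd p) -` S)"
    using S(1) by (intro open_vimage continuous_intros)
  then obtain A B where AB: "open A" "open B" "(0, 0) \<in> A \<times> B"
    "A \<times> B \<subseteq> (\<lambda>p. fst p + x + snd p) -` S"
    by (rule open_prod_elim[of _ "(0, 0)"]) (use S(2) in auto)
  have "P (u + x + v)" if "u \<in> A \<inter> B" "v \<in> A \<inter> B" for u v
  proof -
    have "(u, v) \<in> A \<times> B" using that by auto
    then show ?thesis using AB(4) S(3) by auto
  qed
  then show "well_inside roelcke_uniformity {x} (Collect P)"
    unfolding well_inside_roelcke_iff using AB(1-3) by (intro exI[of _ "A \<inter> B"]) auto
next
  assume "well_inside roelcke_uniformity {x} (Collect P)"
  then obtain N where N: "open N" "0 \<in> N" "\<And>u v. u \<in> N \<Longrightarrow> v \<in> N \<Longrightarrow> P (u + x + v)"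
    unfolding well_inside_roelcke_iff by blast
  have "open ((\<lambda>y. y - x) -` N)"
    using N(1) by (intro open_vimage continuous_intros)
  moreover have "P y" if "y \<in> (\<lambda>y. y - x) -` N" for y
    using N(3)[of "y - x" 0] N(2) that by simp
  ultimately show "eventually P (nhds x)"
    unfolding eventually_nhds using N(2) by (intro exI[of _ "(\<lambda>y. y - x) -` N"]) auto
qed

global_interpretation roelcke: compatible_uniformity
  "roelcke_uniformity :: ('a::{topological_group_add, t2_space} \<times> 'a) filter"
  by unfold_locales (rule is_uniformity_roelcke, rule eventually_nhds_iff_roelcke)

section \<open>Translations and inversion on the Roelcke compactification\<close>

lemma well_inside_roelcke_translation:
  fixes g :: "'a::topological_group_add"
  assumes "well_inside roelcke_uniformity A B"
  shows "well_inside roelcke_uniformity ((+) g -` A) ((+) g -` B)"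
proof -
  obtain N where N: "open N" "0 \<in> N" "\<And>x u v. x \<in> A \<Longrightarrow> u \<in> N \<Longrightarrow> v \<in> N \<Longrightarrow> u + x + v \<in> B"
    using assms unfolding well_inside_roelcke_iff by blast
  \<comment> \<open>Moving u past g conjugates it, as g + (u + x + v) = (g + u - g) + (g + x) + v,
    so the conjugate by g must stay in N as well.\<close>
  define M where "M = N \<inter> (\<lambda>u. g + u + - g) -` N"
  have "open M"
    unfolding M_def using N(1) by (intro open_Int open_vimage continuous_intros)
  moreover have "0 \<in> M" unfolding M_def using N(2) by simp
  moreover have "g + (u + x + v) \<in> B" if "g + x \<in> A" "u \<in> M" "v \<in> M" for x u v
    using N(3)[OF that(1), of "g + u + - g" v] that(2,3) unfolding M_def
    by (simp add: add.assoc del: add_uminus_conv_diff)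
  ultimately show ?thesis
    unfolding well_inside_roelcke_iff by (intro exI[of _ M]) auto
qed

lemma well_inside_roelcke_uminus:
  fixes A B :: "'a::topological_group_add set"
  assumes "well_inside roelcke_uniformity A B"
  shows "well_inside roelcke_uniformity (uminus -` A) (uminus -` B)"
proof -
  obtain N where N: "open N" "0 \<in> N" "\<And>x u v. x \<in> A \<Longrightarrow> u \<in> N \<Longrightarrow> v \<in> N \<Longrightarrow> u + x + v \<in> B"
    using assms unfolding well_inside_roelcke_iff by blast
  have "open (uminus -` N)"
    using N(1) by (intro open_vimage continuous_intros)
  \<comment> \<open>Inversion exchanges the two sides: - v now stands on the left and - u on the
    right.\<close>
  moreover have "- (u + x + v) \<in> B" if "- x \<in> A" "- u \<in> N" "- v \<in> N" for x u v
    using N(3)[OF that(1,3,2)] by (simp add: minus_add add.assoc)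
  ultimately show ?thesis
    unfolding well_inside_roelcke_iff using N(2) by (intro exI[of _ "uminus -` N"]) auto
qed

lemma roelcke_translation_automorphism:
  "roelcke.proximal_automorphism ((+) (g :: 'a::{topological_group_add, t2_space}))"
proof -
  have "(+) g ` A = (+) (- g) -` A" for A
    by (auto simp: image_iff) (metis add_minus_cancel)
  then show ?thesis
    unfolding roelcke.proximal_automorphism_def by (simp add: well_inside_roelcke_translation)
qed

lemma roelcke_uminus_automorphism:
  "roelcke.proximal_automorphism (uminus :: 'a::{topological_group_add, t2_space} \<Rightarrow> 'a)"
proof -
  have "uminus ` A = uminus -` A" for A :: "'a set"
    by (auto simp: image_iff) (metis minus_minus)
  then show ?thesis
    unfolding roelcke.proximal_automorphism_def by (simp add: well_inside_roelcke_uminus)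
qed

lemma roelcke_space_eq:
  "roelcke_space = completion_topology (finest_totally_bounded roelcke_uniformity)"
  and roelcke_map_eq_nhds: "roelcke_map = (nhds :: 'a::{topological_group_add, t2_space} \<Rightarrow> 'a filter)"
  unfolding roelcke_space_def samuel_space_def roelcke_map_def samuel_map_def
    roelcke.completion_map_eq_nhds by (rule refl)+

lemma continuous_action_roelcke:
  "continuous_action (roelcke_space :: 'a::{topological_group_add, t2_space} filter topology)
     (\<lambda>g. filtermap ((+) g))"
  unfolding continuous_action_def roelcke_space_eq
proof (intro conjI allI ballI)
  let ?P = "completion_points (finest_totally_bounded (roelcke_uniformity :: ('a \<times> 'a) filter))"
  let ?Y = "completion_topology (finest_totally_bounded (roelcke_uniformity :: ('a \<times> 'a) filter))"
  have pt: "filtermap ((+) g) F \<in> ?P" if "F \<in> ?P" for g F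
    using roelcke_translation_automorphism that by (rule roelcke.filtermap_point)
  show "continuous_map (prod_topology euclidean ?Y) ?Y (\<lambda>(g, F). filtermap ((+) g) F)"
    unfolding continuous_map_def topspace_prod_topology roelcke.topspace_completion
  proof (intro conjI allI impI)
    show "(\<lambda>(g, F). filtermap ((+) g) F) \<in> topspace euclidean \<times> ?P \<rightarrow> ?P"
      using pt by auto
    fix W assume W: "openin ?Y W"
    show "openin (prod_topology euclidean ?Y)
        {p \<in> topspace euclidean \<times> ?P. (case p of (g, F) \<Rightarrow> filtermap ((+) g) F) \<in> W}"
      unfolding openin_prod_topology_alt
    proof (intro allI impI)
      fix g F assume "(g, F) \<in> {p \<in> topspace euclidean \<times> ?P. (case p of (g, F) \<Rightarrow> filtermap ((+) g) F) \<in> W}"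
      then have F: "F \<in> ?P" "filtermap ((+) g) F \<in> W" by auto
      obtain A where A: "\<forall>\<^sub>F x in filtermap ((+) g) F. x \<in> A" "roelcke.basic_open A \<subseteq> W"
        using F(2) W unfolding roelcke.openin_completion_iff by blast
      obtain B where B: "\<forall>\<^sub>F x in filtermap ((+) g) F. x \<in> B" "well_inside roelcke_uniformity B A"
        using roelcke.point_round[OF pt[OF F(1)] A(1)] by blast
      obtain N where N: "open N" "0 \<in> N" "\<And>x u v. x \<in> B \<Longrightarrow> u \<in> N \<Longrightarrow> v \<in> N \<Longrightarrow> u + x + v \<in> A"
        using B(2) unfolding well_inside_roelcke_iff by blast
      \<comment> \<open>Joint continuity: h + x = (h - g) + (g + x), so one neighbourhood N moves
        every x with g + x in B into A at once. The bound is uniform in x, hence valid for all G in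
        the basic open set.\<close>
      have "filtermap ((+) h) G \<in> W" if h: "h - g \<in> N" and G: "G \<in> roelcke.basic_open ((+) g -` B)" for h G
      proof -
        have "h + x \<in> A" if "g + x \<in> B" for x
          using N(3)[OF that h N(2)] by (simp add: add.assoc[symmetric])
        then have "\<forall>\<^sub>F x in filtermap ((+) h) G. x \<in> A"
          unfolding eventually_filtermap using roelcke.mem_basic_openD(2)[OF G]
          by (auto elim: eventually_mono)
        then show ?thesis
          using A(2) pt[OF roelcke.mem_basic_openD(1)[OF G]] unfolding roelcke.basic_open_def by auto
      qed
      moreover have "open ((\<lambda>h. h - g) -` N)"
        using N(1) by (intro open_vimage continuous_intros)
      moreover have "F \<in> roelcke.basic_open ((+) g -` B)"
        using F(1) B(1) unfolding roelcke.basic_open_def by (simp add: eventually_filtermap)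
      ultimately show "\<exists>S T. openin euclidean S \<and> openin ?Y T \<and> g \<in> S \<and> F \<in> T \<and>
          S \<times> T \<subseteq> {p \<in> topspace euclidean \<times> ?P. (case p of (g, F) \<Rightarrow> filtermap ((+) g) F) \<in> W}"
        using N(2) roelcke.openin_basic_open roelcke.mem_basic_openD(1)
        by (intro exI[of _ "(\<lambda>h. h - g) -` N"] exI[of _ "roelcke.basic_open ((+) g -` B)"])
          (fastforce simp: roelcke.basic_open_def)
    qed
  qed
  have "(+) (0::'a) = (\<lambda>x. x)" by (simp add: fun_eq_iff)
  then show "filtermap ((+) 0) F = F" for F :: "'a filter"
    by (simp add: filtermap_ident)
  show "filtermap ((+) (g + h)) F = filtermap ((+) g) (filtermap ((+) h) F)" for g h and F :: "'a filter"
  proof -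
    have "(+) (g + h) = (\<lambda>x. g + (h + x))" by (simp add: fun_eq_iff add.assoc)
    then show ?thesis by (simp add: filtermap_filtermap)
  qed
qed

lemma G_star_compactification_roelcke:
  "G_star_compactification roelcke_space
     (roelcke_map :: 'a::{topological_group_add, t2_space} \<Rightarrow> 'a filter)"
  unfolding G_star_compactification_def G_compactification_def
proof (intro conjI exI ballI allI)
  show "is_compactification roelcke_space (roelcke_map :: 'a \<Rightarrow> 'a filter)"
    using roelcke.is_compactification_completion
    unfolding roelcke_space_eq roelcke_map_eq_nhds roelcke.completion_map_eq_nhds .
  show "extends_to_continuous_action left_translation roelcke_space (roelcke_map :: 'a \<Rightarrow> 'a filter)"
    unfolding extends_to_continuous_action_def left_translation_def roelcke_map_eq_nhds
    using continuous_action_roelcke roelcke.filtermap_nhds[OF roelcke_translation_automorphism] by blast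
  show "continuous_map roelcke_space roelcke_space (filtermap (uminus :: 'a \<Rightarrow> 'a))"
    unfolding roelcke_space_eq
    using roelcke_uminus_automorphism by (rule roelcke.continuous_map_filtermap)
  show "filtermap uminus (filtermap uminus F) = F" for F :: "'a filter"
    by (simp add: filtermap_filtermap filtermap_ident)
  show "filtermap uminus (roelcke_map g) = roelcke_map (- g)" for g :: 'a
    unfolding roelcke_map_eq_nhds
    using roelcke_uminus_automorphism by (rule roelcke.filtermap_nhds)
qed

section \<open>Maximality\<close>

text \<open>Conjugating the left action by the involution extends the right action.\<close>

lemma G_star_imp_G_lr_compactification:
  assumes "G_star_compactification Y b"
  shows "G_lr_compactification Y b"
proof -
  obtain s act where s: "continuous_map Y Y s" "\<And>y. y \<in> topspace Y \<Longrightarrow> s (s y) = y"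
      "\<And>g. s (b g) = b (- g)"
    and act: "continuous_map (prod_topology euclidean Y) Y (\<lambda>(g, y). act g y)"
      "\<And>y. y \<in> topspace Y \<Longrightarrow> act 0 y = y"
      "\<And>g h y. y \<in> topspace Y \<Longrightarrow> act (g + h) y = act g (act h y)"
      "\<And>g h. act g (b h) = b (g + h)"
    using assms unfolding G_star_compactification_def G_compactification_def
      extends_to_continuous_action_def continuous_action_def left_translation_def by metis
  have s_top: "s y \<in> topspace Y" if "y \<in> topspace Y" for y
    using s(1) that by (rule continuous_map_image_subset_topspace[THEN subsetD, OF _ imageI])
  have act_top: "act g y \<in> topspace Y" if "y \<in> topspace Y" for g y
    using continuous_map_image_subset_topspace[OF act(1)] that by auto
  have "continuous_map (prod_topology euclidean Y) (prod_topology euclidean Y) (\<lambda>p. (fst p, s (snd p)))"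
    by (intro continuous_map_pairedI continuous_map_fst continuous_map_compose[OF continuous_map_snd s(1), unfolded o_def])
  from continuous_map_compose[OF continuous_map_compose[OF this act(1)] s(1)]
  have "continuous_map (prod_topology euclidean Y) Y (\<lambda>(g, y). s (act g (s y)))"
    by (simp add: o_def case_prod_unfold)
  then have "continuous_action Y (\<lambda>g y. s (act g (s y)))"
    unfolding continuous_action_def by (auto simp: s(2) act(2,3) s_top act_top)
  moreover have "s (act g (s (b h))) = b (h - g)" for g h
    by (simp add: s(3) act(4) minus_add)
  ultimately have "extends_to_continuous_action right_translation Y b"
    unfolding extends_to_continuous_action_def right_translation_def by blast
  then show ?thesis
    using assms unfolding G_star_compactification_def G_compactification_def G_lr_compactification_def
    by blast
qed

lemma well_inside_roelcke_vimage:
  fixes b :: "'a::topological_group_add \<Rightarrow> 'b"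
  assumes Y: "G_lr_compactification Y b"
    and "closedin Y C" "openin Y W" "C \<subseteq> W"
  shows "well_inside roelcke_uniformity (b -` C) (b -` W)"
proof -
  obtain l r where l: "continuous_action Y l" "\<And>g h. l g (b h) = b (g + h)"
    and r: "continuous_action Y r" "\<And>g h. r g (b h) = b (h - g)"
    using Y unfolding G_lr_compactification_def extends_to_continuous_action_def
      left_translation_def right_translation_def by metis
  let ?X = "prod_topology (prod_topology euclidean euclidean) Y"
  \<comment> \<open>The two actions are combined into the map sending ((u, w), y) to
    \<open>l u (r w y)\<close>. It is the identity in y at (0, 0), and on the group it sends x to u
    + x - w.\<close>
  have "continuous_map ?X (prod_topology euclidean Y) (\<lambda>p. (snd (fst p), snd p))"
    by (intro continuous_map_pairedI continuous_map_snd
        continuous_map_compose[OF continuous_map_fst continuous_map_snd, unfolded o_def])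
  from continuous_map_compose[OF this] r(1)
  have "continuous_map ?X Y (\<lambda>p. r (snd (fst p)) (snd p))"
    unfolding continuous_action_def by (fastforce simp: o_def)
  then have "continuous_map ?X (prod_topology euclidean Y) (\<lambda>p. (fst (fst p), r (snd (fst p)) (snd p)))"
    by (intro continuous_map_pairedI
        continuous_map_compose[OF continuous_map_fst continuous_map_fst, unfolded o_def])
  from continuous_map_compose[OF this] l(1)
  have cont: "continuous_map ?X Y (\<lambda>p. l (fst (fst p)) (r (snd (fst p)) (snd p)))"
    unfolding continuous_action_def by (fastforce simp: o_def)
  let ?S = "{p \<in> topspace ?X. l (fst (fst p)) (r (snd (fst p)) (snd p)) \<in> W}"
  have "compactin (prod_topology euclidean euclidean) {(0 :: 'a, 0 :: 'a)}"
    by simp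
  moreover have "compactin Y C"
    using Y assms(2) closedin_compact_space
    unfolding G_lr_compactification_def is_compactification_def by blast
  moreover have "openin ?X ?S"
    using cont assms(3) by (rule openin_continuous_map_preimage)
  moreover have "{(0, 0)} \<times> C \<subseteq> ?S"
  proof -
    have "l 0 (r 0 y) = y" if "y \<in> C" for y
      using closedin_subset[OF assms(2)] l(1) r(1) that unfolding continuous_action_def by auto
    then show ?thesis
      using closedin_subset[OF assms(2)] assms(4) by auto
  qed
  \<comment> \<open>The tube lemma around {(0, 0)} and the compact set C: parameters near (0, 0)
    carry all of C into W.\<close>
  ultimately obtain S T where ST: "openin (prod_topology euclidean euclidean) S" "openin Y T"
    "{(0, 0)} \<subseteq> S" "C \<subseteq> T" "S \<times> T \<subseteq> ?S"
    by (rule Wallace_theorem_prod_topology) (rule that)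
  then obtain M N where MN: "open M" "open N" "0 \<in> M" "0 \<in> N" "M \<times> N \<subseteq> S"
    unfolding openin_prod_topology_alt by (metis insert_subset open_openin)
  \<comment> \<open>The right action subtracts its parameter, so it is used at - v; this is why the
    final neighbourhood is M intersected with the negatives of N.\<close>
  have "b (u + x + v) \<in> W" if "b x \<in> C" "u \<in> M" "- v \<in> N" for x u v
  proof -
    have "((u, - v), b x) \<in> ?S"
      using that MN(5) ST(4,5) by blast
    then show ?thesis by (simp add: l(2) r(2) add.assoc)
  qed
  moreover have "open (uminus -` N)"
    using MN(2) by (intro open_vimage continuous_intros)
  ultimately show ?thesis
    unfolding well_inside_roelcke_iff using MN
    by (intro exI[of _ "M \<inter> uminus -` N"]) auto
qed

lemma G_lr_compactification_le_roelcke: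
  fixes b :: "'a::{topological_group_add, t2_space} \<Rightarrow> 'b"
  assumes Y: "G_lr_compactification Y b"
  shows "compactification_le Y b roelcke_space roelcke_map"
proof -
  have c: "is_compactification Y b"
    using Y unfolding G_lr_compactification_def by blast
  then have "continuous_map euclidean Y b"
    unfolding is_compactification_def embedding_map_def
    using homeomorphic_imp_continuous_map continuous_map_in_subtopology by blast
  from continuous_map_image_subset_topspace[OF this] have "range b \<subseteq> topspace Y" by simp
  with c show ?thesis
    unfolding roelcke_space_def samuel_space_def roelcke_map_def samuel_map_def is_compactification_def
    by (intro roelcke.compactification_le_completion well_inside_roelcke_vimage[OF Y]) auto
qed

theorem proposition3p4:
  shows
    "(G_lr_compactification roelcke_space
        (roelcke_map :: 'a::{topological_group_add, t2_space} \<Rightarrow> 'a filter) \<and>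
      (\<forall>(Y :: 'b topology) (b :: 'a \<Rightarrow> 'b).
         G_lr_compactification Y b \<longrightarrow>
         compactification_le Y b roelcke_space (roelcke_map :: 'a \<Rightarrow> 'a filter))) \<and>
     (G_star_compactification roelcke_space (roelcke_map :: 'a \<Rightarrow> 'a filter) \<and>
      (\<forall>(Y :: 'b topology) (b :: 'a \<Rightarrow> 'b).
         G_star_compactification Y b \<longrightarrow>
         compactification_le Y b roelcke_space (roelcke_map :: 'a \<Rightarrow> 'a filter)))"
  \<comment> \<open>Since \<open>G_star_compactification\<close> implies
    \<open>G_lr_compactification\<close>, membership is proved for the former class and the upper
    bound for the latter; the other two claims follow.\<close>
  by (intro conjI allI impI G_star_compactification_roelcke
      G_star_imp_G_lr_compactification[OF G_star_compactification_roelcke])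
    (erule G_lr_compactification_le_roelcke,
      erule G_lr_compactification_le_roelcke[OF G_star_imp_G_lr_compactification])

end
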